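(* Let $p$ be a prime and let $M$ be a Moufang $p$-loop with a unique subloop of order $p$. Then $M$ is a cyclic group, a generalized quaternion group, or a generalized octonion loop. Moreover, the last two cases occur only when $p=2$.
   Context: A loop is a set with a binary operation whose multiplication table is a Latin square and which has a two-sided identity $1$. A Moufang loop is a loop satisfying the (equivalent) Moufang identities, e.g. $z\cdot(x\cdot zy)=(zx\cdot z)\cdot y$ for all $x,y,z$. A Moufang $p$-loop is a finite Moufang loop whose order is a power of the prime $p$. The generalized quaternion groups are the groups $Q_{4n}=\langle a,b : a^n=b^2,\ a^{2n}=1,\ b^{-1}ab=a^{-1}\rangle$ with $n\ge 2$ a power of $2$ (noncyclic $2$-groups). A generalized octonion loop is a nonassociative Moufang $p$-loop (for some prime $p$) in which every abelian subloop (i.e. every associative and commutative subloop) is cyclic. *)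

theory Defs
  imports "HOL-Algebra.Elementary_Groups" "HOL-Computational_Algebra.Primes"
begin

section \<open>Moufang loops\<close>

text \<open>
  The structure of a loop is carried by the \<open>monoid\<close> record of HOL-Algebra, used only as a
  signature (carrier, product, identity).  The two \<open>bij_betw\<close> conditions say that the
  multiplication table is a Latin square; they include closure of the product.
\<close>

locale loop =
  fixes M (structure)
  assumes one_closed: "\<one> \<in> carrier M"
    and l_one: "x \<in> carrier M \<Longrightarrow> \<one> \<otimes> x = x"
    and r_one: "x \<in> carrier M \<Longrightarrow> x \<otimes> \<one> = x"
    and row_bij: "x \<in> carrier M \<Longrightarrow> bij_betw (\<lambda>y. x \<otimes> y) (carrier M) (carrier M)"
    and col_bij: "x \<in> carrier M \<Longrightarrow> bij_betw (\<lambda>y. y \<otimes> x) (carrier M) (carrier M)"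

locale moufang_loop = loop M for M (structure) +
  assumes moufang: "\<lbrakk>x \<in> carrier M; y \<in> carrier M; z \<in> carrier M\<rbrakk>
    \<Longrightarrow> z \<otimes> (x \<otimes> (z \<otimes> y)) = ((z \<otimes> x) \<otimes> z) \<otimes> y"

definition moufang_p_loop :: "nat \<Rightarrow> ('a, 'b) monoid_scheme \<Rightarrow> bool" where
  "moufang_p_loop p M \<longleftrightarrow>
     prime p \<and> moufang_loop M \<and> finite (carrier M) \<and> (\<exists>k. order M = p ^ k)"

definition subloop :: "'a set \<Rightarrow> ('a, 'b) monoid_scheme \<Rightarrow> bool" where
  "subloop H M \<longleftrightarrow> H \<subseteq> carrier M \<and> loop (M\<lparr>carrier := H\<rparr>)"

definition associative_loop :: "('a, 'b) monoid_scheme \<Rightarrow> bool" where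
  "associative_loop M \<longleftrightarrow> loop M \<and>
     (\<forall>x\<in>carrier M. \<forall>y\<in>carrier M. \<forall>z\<in>carrier M.
        (x \<otimes>\<^bsub>M\<^esub> y) \<otimes>\<^bsub>M\<^esub> z = x \<otimes>\<^bsub>M\<^esub> (y \<otimes>\<^bsub>M\<^esub> z))"

definition commutative_loop :: "('a, 'b) monoid_scheme \<Rightarrow> bool" where
  "commutative_loop M \<longleftrightarrow> loop M \<and>
     (\<forall>x\<in>carrier M. \<forall>y\<in>carrier M. x \<otimes>\<^bsub>M\<^esub> y = y \<otimes>\<^bsub>M\<^esub> x)"

definition abelian_subloop :: "'a set \<Rightarrow> ('a, 'b) monoid_scheme \<Rightarrow> bool" where
  "abelian_subloop H M \<longleftrightarrow> subloop H M \<and>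
     associative_loop (M\<lparr>carrier := H\<rparr>) \<and> commutative_loop (M\<lparr>carrier := H\<rparr>)"

text \<open>
  The library predicate \<^const>\<open>cyclic_group\<close> does not itself assert the group axioms.
\<close>

definition is_cyclic_group :: "('a, 'b) monoid_scheme \<Rightarrow> bool" where
  "is_cyclic_group G \<longleftrightarrow> group G \<and> cyclic_group G"

definition generalized_octonion_loop :: "('a, 'b) monoid_scheme \<Rightarrow> bool" where
  "generalized_octonion_loop M \<longleftrightarrow>
     (\<exists>p. moufang_p_loop p M) \<and> \<not> associative_loop M \<and>
     (\<forall>H. abelian_subloop H M \<longrightarrow> is_cyclic_group (M\<lparr>carrier := H\<rparr>))"


section \<open>Groups given by generators and relations\<close>

text \<open>
  A word is a list of letters; the letter \<open>(g, True)\<close> stands for the generator \<open>g\<close> and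
  \<open>(g, False)\<close> for its formal inverse.  A pair \<open>(u, v)\<close> in \<open>R\<close> is the defining relation
  \<open>u = v\<close>.
\<close>

type_synonym 'g word = "('g \<times> bool) list"

inductive word_eq :: "('g word \<times> 'g word) set \<Rightarrow> 'g word \<Rightarrow> 'g word \<Rightarrow> bool"
  for R :: "('g word \<times> 'g word) set" where
  rel: "(u, v) \<in> R \<Longrightarrow> word_eq R u v"
| cancel: "word_eq R [(g, e), (g, \<not> e)] []"
| refl: "word_eq R u u"
| sym: "word_eq R u v \<Longrightarrow> word_eq R v u"
| trans: "word_eq R u v \<Longrightarrow> word_eq R v w \<Longrightarrow> word_eq R u w"
| append: "word_eq R u u' \<Longrightarrow> word_eq R v v' \<Longrightarrow> word_eq R (u @ v) (u' @ v')"

definition word_class :: "('g word \<times> 'g word) set \<Rightarrow> 'g word \<Rightarrow> 'g word set" where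
  "word_class R u = {w. word_eq R u w}"

definition presented_group :: "('g word \<times> 'g word) set \<Rightarrow> 'g word set monoid" where
  "presented_group R =
     \<lparr>carrier = range (word_class R),
      monoid.mult = (\<lambda>X Y. {w. \<exists>u\<in>X. \<exists>v\<in>Y. word_eq R (u @ v) w}),
      one = word_class R []\<rparr>"

lemma word_class_eq_iff: "word_class R u = word_class R v \<longleftrightarrow> word_eq R u v"
  unfolding word_class_def
  by (auto intro: word_eq.refl word_eq.sym word_eq.trans)

lemma mult_word_class:
  "word_class R u \<otimes>\<^bsub>presented_group R\<^esub> word_class R v = word_class R (u @ v)"
  unfolding presented_group_def word_class_def
  by (auto intro: word_eq.refl word_eq.sym word_eq.trans word_eq.append)

lemma word_eq_left_inverse:
  "word_eq R (rev (map (\<lambda>(g, e). (g, \<not> e)) u) @ u) []"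
proof (induction u)
  case Nil
  show ?case by (simp add: word_eq.refl)
next
  case (Cons x u)
  obtain g e where x: "x = (g, e)" by (cases x)
  let ?i = "rev (map (\<lambda>(g, e). (g, \<not> e)) u)"
  have "word_eq R [(g, \<not> e), (g, e)] []"
    using word_eq.cancel[of R g "\<not> e"] by simp
  from word_eq.append[OF word_eq.refl word_eq.append[OF this word_eq.refl]]
  have "word_eq R (?i @ [(g, \<not> e), (g, e)] @ u) (?i @ [] @ u)" .
  then show ?case
    using Cons.IH x by (auto intro: word_eq.trans)
qed

lemma group_presented_group: "group (presented_group R)"
proof (rule groupI)
  have carr: "carrier (presented_group R) = range (word_class R)"
    and one: "\<one>\<^bsub>presented_group R\<^esub> = word_class R []"
    by (simp_all add: presented_group_def)
  show "\<one>\<^bsub>presented_group R\<^esub> \<in> carrier (presented_group R)"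
    by (simp add: carr one)
  show "X \<otimes>\<^bsub>presented_group R\<^esub> Y \<in> carrier (presented_group R)"
    if "X \<in> carrier (presented_group R)" "Y \<in> carrier (presented_group R)" for X Y
    using that by (auto simp: carr mult_word_class)
  show "(X \<otimes>\<^bsub>presented_group R\<^esub> Y) \<otimes>\<^bsub>presented_group R\<^esub> Z =
      X \<otimes>\<^bsub>presented_group R\<^esub> (Y \<otimes>\<^bsub>presented_group R\<^esub> Z)"
    if "X \<in> carrier (presented_group R)" "Y \<in> carrier (presented_group R)"
      "Z \<in> carrier (presented_group R)" for X Y Z
    using that by (auto simp: carr mult_word_class)
  show "\<one>\<^bsub>presented_group R\<^esub> \<otimes>\<^bsub>presented_group R\<^esub> X = X"
    if "X \<in> carrier (presented_group R)" for X
    using that by (auto simp: carr one mult_word_class)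
  show "\<exists>Y\<in>carrier (presented_group R).
      Y \<otimes>\<^bsub>presented_group R\<^esub> X = \<one>\<^bsub>presented_group R\<^esub>"
    if "X \<in> carrier (presented_group R)" for X
    using that word_eq_left_inverse by (fastforce simp: carr one mult_word_class word_class_eq_iff)
qed


section \<open>Generalized quaternion groups\<close>

datatype quat_gen = Gen_a | Gen_b

definition quaternion_relations :: "nat \<Rightarrow> (quat_gen word \<times> quat_gen word) set" where
  "quaternion_relations n =
     {(replicate n (Gen_a, True), replicate 2 (Gen_b, True)),
      (replicate (2 * n) (Gen_a, True), []),
      ([(Gen_b, False), (Gen_a, True), (Gen_b, True)], [(Gen_a, False)])}"

text \<open>\<open>quaternion_group n\<close> is the group $Q_{4n}$; the parameter is a quarter of the order.\<close>

definition quaternion_group :: "nat \<Rightarrow> quat_gen word set monoid" where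
  "quaternion_group n = presented_group (quaternion_relations n)"

definition generalized_quaternion_group :: "('a, 'b) monoid_scheme \<Rightarrow> bool" where
  "generalized_quaternion_group G \<longleftrightarrow>
     group G \<and> (\<exists>n k. n \<ge> 2 \<and> n = 2 ^ k \<and> G \<cong> quaternion_group n)"

end

theory Submission
  imports Defs "HOL-Algebra.Sylow" "HOL-Algebra.Group_Action" "HOL-Number_Theory.Residues"
begin

text \<open>
  Moufang loops are diassociative, so any two elements \<open>x, y\<close> lie in a group, which is again a
  \<open>p\<close>-group with a unique subgroup of order \<open>p\<close>.  For odd \<open>p\<close> such a group is cyclic; if \<open>x\<close>
  generates a cyclic subloop of maximal size, then \<open>y\<close> must lie in that subloop, hence the whole
  loop is cyclic.  For \<open>p = 2\<close> an associative loop is covered by the classical theorem on groups, and in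
  a nonassociative one every abelian subloop is an abelian group with a unique involution.

  For a group, choose a maximal cyclic normal subgroup \<open>\<langle>a\<rangle>\<close>.  It is its own centralizer.  An element
  \<open>b\<close> outside with \<open>b\<^sup>p \<in> \<langle>a\<rangle>\<close> acts by \<open>a \<mapsto> a\<^sup>r\<close>, and \<open>(b a\<^sup>i)\<^sup>p = b\<^sup>p a\<^sup>i\<^sup>s\<close> with
  \<open>s = 1 + r + \<dots> + r\<^sup>p\<^sup>-\<^sup>1\<close>.  If \<open>p\<close> divides \<open>s\<close> only once, some \<open>i\<close> makes this trivial,
  which gives a second subgroup of order \<open>p\<close>.  So \<open>p = 2\<close> and \<open>r \<equiv> 3\<close> modulo 4, which forces
  \<open>r = -1\<close>; as \<open>-1\<close> is not a square modulo 4, \<open>\<langle>a\<rangle>\<close> has index 2.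
\<close>

section \<open>Moufang loops are diassociative\<close>

context loop
begin

lemma m_closed: "x \<in> carrier M \<Longrightarrow> y \<in> carrier M \<Longrightarrow> x \<otimes> y \<in> carrier M"
  using row_bij by (auto simp: bij_betw_def)

lemma l_cancel: "\<lbrakk>x \<otimes> y = x \<otimes> z; x \<in> carrier M; y \<in> carrier M; z \<in> carrier M\<rbrakk> \<Longrightarrow> y = z"
  using row_bij by (auto simp: bij_betw_def inj_on_def)

lemma r_cancel: "\<lbrakk>y \<otimes> x = z \<otimes> x; x \<in> carrier M; y \<in> carrier M; z \<in> carrier M\<rbrakk> \<Longrightarrow> y = z"
  using col_bij by (auto simp: bij_betw_def inj_on_def)

lemma l_solvable: "x \<in> carrier M \<Longrightarrow> z \<in> carrier M \<Longrightarrow> \<exists>y\<in>carrier M. x \<otimes> y = z"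
  using row_bij[of x] unfolding bij_betw_def by (metis imageE)

end

section \<open>Inverse properties and shift identities of Moufang loops\<close>

context moufang_loop
begin

lemma flexible: "x \<in> carrier M \<Longrightarrow> z \<in> carrier M \<Longrightarrow> (z \<otimes> x) \<otimes> z = z \<otimes> (x \<otimes> z)"
  using moufang[of x \<one> z] by (simp add: one_closed r_one m_closed)

text \<open>For a right inverse \<open>x\<close> of \<open>z\<close>, Moufang's identity reads
  z(x(zy)) = ((zx)z)y = zy. Cancelling \<open>z\<close> yields the left inverse property, and y = 1
  makes \<open>x\<close> a two-sided inverse.\<close>

lemma inverse_exists:
  assumes z: "z \<in> carrier M"
  shows "\<exists>x\<in>carrier M. z \<otimes> x = \<one> \<and> x \<otimes> z = \<one> \<and> (\<forall>y\<in>carrier M. x \<otimes> (z \<otimes> y) = y)"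
proof -
  obtain x where x: "x \<in> carrier M" "z \<otimes> x = \<one>"
    using l_solvable z one_closed by blast
  have lip: "x \<otimes> (z \<otimes> y) = y" if y: "y \<in> carrier M" for y
  proof (rule l_cancel)
    show "z \<otimes> (x \<otimes> (z \<otimes> y)) = z \<otimes> y"
      using moufang[of x y z] x y z by (simp add: l_one)
  qed (use x y z in \<open>auto intro: m_closed\<close>)
  show ?thesis using x lip lip[OF one_closed] z by (auto simp: r_one)
qed

text \<open>\<open>inv\<close> is a definite description, so it has a usable value only once
  two-sided inverses are unique; left cancellation provides that.\<close>

lemma inv_props:
  assumes z: "z \<in> carrier M"
  shows inv_closed: "inv z \<in> carrier M" and r_inv: "z \<otimes> inv z = \<one>" and l_inv: "inv z \<otimes> z = \<one>"
proof -
  obtain x where x: "x \<in> carrier M" "z \<otimes> x = \<one>" "x \<otimes> z = \<one>"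
    using inverse_exists[OF z] by blast
  have "inv z = x"
    unfolding m_inv_def
  proof (rule the_equality)
    show "x \<in> carrier M \<and> z \<otimes> x = \<one> \<and> x \<otimes> z = \<one>" using x by simp
    show "y = x" if "y \<in> carrier M \<and> z \<otimes> y = \<one> \<and> y \<otimes> z = \<one>" for y
      using that x z l_cancel[of z y x] by simp
  qed
  with x show "inv z \<in> carrier M" "z \<otimes> inv z = \<one>" "inv z \<otimes> z = \<one>" by auto
qed

lemmas loop_closed = m_closed inv_closed one_closed

lemma inv_unique: "\<lbrakk>x \<in> carrier M; z \<in> carrier M; z \<otimes> x = \<one>\<rbrakk> \<Longrightarrow> inv z = x"
  using l_cancel[of z "inv z" x] r_inv inv_closed by simp

lemma inv_inv: "z \<in> carrier M \<Longrightarrow> inv (inv z) = z"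
  using inv_unique[of z "inv z"] inv_closed l_inv by simp

lemma inv_one: "inv \<one> = \<one>"
  using inv_unique[of \<one> \<one>] one_closed l_one by simp

lemma l_inv_cancel:
  assumes "z \<in> carrier M" "y \<in> carrier M"
  shows "inv z \<otimes> (z \<otimes> y) = y"
proof -
  obtain x where x: "x \<in> carrier M" "z \<otimes> x = \<one>" "x \<otimes> (z \<otimes> y) = y"
    using inverse_exists[OF assms(1)] assms(2) by blast
  with inv_unique[of x z] assms show ?thesis by simp
qed

lemma l_inv_cancel': "z \<in> carrier M \<Longrightarrow> y \<in> carrier M \<Longrightarrow> z \<otimes> (inv z \<otimes> y) = y"
  using l_inv_cancel[of "inv z" y] inv_inv inv_closed by simp

text \<open>Moufang's identity with \<open>y\<close> replaced by \<open>z\<inverse>y\<close>: an autotopism of the loop.\<close>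

lemma moufang_shift:
  assumes "x \<in> carrier M" "y \<in> carrier M" "z \<in> carrier M"
  shows "((z \<otimes> x) \<otimes> z) \<otimes> (inv z \<otimes> y) = z \<otimes> (x \<otimes> y)"
  using moufang[of x "inv z \<otimes> y" z] assms by (simp add: l_inv_cancel' loop_closed)

text \<open>In \<open>moufang_shift\<close> take \<open>inv z \<otimes> w\<close> as the first
  factor and the identity as the second: both sides collapse to the right inverse property.\<close>

lemma r_inv_cancel:
  assumes "w \<in> carrier M" "z \<in> carrier M"
  shows "(w \<otimes> z) \<otimes> inv z = w"
  using moufang_shift[of "inv z \<otimes> w" \<one> z] assms by (simp add: l_inv_cancel' loop_closed r_one)

lemma r_inv_cancel': "w \<in> carrier M \<Longrightarrow> z \<in> carrier M \<Longrightarrow> (w \<otimes> inv z) \<otimes> z = w"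
  using r_inv_cancel[of w "inv z"] inv_inv inv_closed by simp

lemma inv_mult:
  assumes "x \<in> carrier M" "y \<in> carrier M"
  shows "inv (x \<otimes> y) = inv y \<otimes> inv x"
proof -
  have "inv (x \<otimes> y) \<otimes> ((x \<otimes> y) \<otimes> inv y) = inv y"
    using l_inv_cancel[of "x \<otimes> y" "inv y"] assms by (simp add: loop_closed)
  then have "inv (x \<otimes> y) \<otimes> x = inv y" using r_inv_cancel assms by simp
  then show ?thesis using r_inv_cancel[of "inv (x \<otimes> y)" x] assms by (simp add: loop_closed)
qed

text \<open>This is \<open>moufang_shift\<close> for \<open>a \<otimes> inv s\<close> and
  \<open>s \<otimes> b\<close>; flexibility reduces its leading factor to
  \<open>s \<otimes> a\<close>. The left factor \<open>s\<close> is pulled out front at the price of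
  inserting \<open>inv s\<close> and \<open>s\<close> between \<open>a\<close> and
  \<open>b\<close>.\<close>

lemma shift_left:
  assumes "a \<in> carrier M" "b \<in> carrier M" "s \<in> carrier M"
  shows "(s \<otimes> a) \<otimes> b = s \<otimes> ((a \<otimes> inv s) \<otimes> (s \<otimes> b))"
proof -
  have "(s \<otimes> (a \<otimes> inv s)) \<otimes> s = s \<otimes> a"
    using assms by (simp add: flexible loop_closed r_inv_cancel')
  then show ?thesis
    using moufang_shift[of "a \<otimes> inv s" "s \<otimes> b" s] assms by (simp add: loop_closed l_inv_cancel)
qed

lemma inv_inject: "\<lbrakk>inv x = inv y; x \<in> carrier M; y \<in> carrier M\<rbrakk> \<Longrightarrow> x = y"
  using inv_inv by metis

text \<open>Inversion reverses products, so \<open>shift_left\<close> for the inverses of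
  \<open>t\<close>, \<open>b\<close> and \<open>a\<close> turns into this mirror image.\<close>

lemma shift_right:
  assumes "a \<in> carrier M" "b \<in> carrier M" "t \<in> carrier M"
  shows "a \<otimes> (b \<otimes> t) = ((a \<otimes> t) \<otimes> (inv t \<otimes> b)) \<otimes> t"
proof (rule inv_inject)
  show "inv (a \<otimes> (b \<otimes> t)) = inv (((a \<otimes> t) \<otimes> (inv t \<otimes> b)) \<otimes> t)"
    using shift_left[of "inv b" "inv a" "inv t"] assms
    by (simp add: inv_mult loop_closed inv_inv)
qed (use assms in \<open>auto intro!: loop_closed\<close>)

text \<open>Pulling the right factor \<open>s\<close> out with \<open>shift_right\<close> leaves
  exactly the left side of \<open>moufang_shift\<close>.\<close>

lemma middle_moufang:
  assumes "a \<in> carrier M" "b \<in> carrier M" "s \<in> carrier M"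
  shows "(s \<otimes> a) \<otimes> (b \<otimes> s) = (s \<otimes> (a \<otimes> b)) \<otimes> s"
  using shift_right[of "s \<otimes> a" b s] moufang_shift[of a b s] assms by (simp add: loop_closed)

end

section \<open>Alternating words over two associating subsets\<close>

text \<open>
  Words alternate between letters from two subsets that act associatively; the intended subsets are the cyclic subloops of two elements.  Runs of a single letter thus
  count as one syllable, and the identity serves as an empty syllable for padding.
\<close>

locale alternating_words = moufang_loop +
  fixes S :: "bool \<Rightarrow> 'a set"
  assumes S_sub: "s \<in> S c \<Longrightarrow> s \<in> carrier M"
    and S_one: "\<one> \<in> S c"
    and S_mult: "s \<in> S c \<Longrightarrow> t \<in> S c \<Longrightarrow> s \<otimes> t \<in> S c"
    and S_inv: "s \<in> S c \<Longrightarrow> inv s \<in> S c"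
    and S_left: "\<lbrakk>s \<in> S c; t \<in> S c; z \<in> carrier M\<rbrakk> \<Longrightarrow> s \<otimes> (t \<otimes> z) = (s \<otimes> t) \<otimes> z"
begin

text \<open>Both subsets are closed under inverses, so inversion turns \<open>S_left\<close> into
  its mirror image.\<close>

lemma S_right:
  assumes "s \<in> S c" "t \<in> S c" "z \<in> carrier M"
  shows "(z \<otimes> s) \<otimes> t = z \<otimes> (s \<otimes> t)"
proof (rule inv_inject)
  show "inv ((z \<otimes> s) \<otimes> t) = inv (z \<otimes> (s \<otimes> t))"
    using assms S_left[of "inv t" c "inv s" "inv z"] by (simp add: inv_mult loop_closed S_sub S_inv)
qed (use assms in \<open>simp_all add: m_closed S_sub\<close>)

fun alternating :: "bool \<Rightarrow> 'a list \<Rightarrow> bool" where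
  "alternating b [] = True"
| "alternating b (s # w) \<longleftrightarrow> s \<in> S b \<and> alternating (\<not> b) w"

definition val :: "'a list \<Rightarrow> 'a" where
  "val w = foldr (\<otimes>) w \<one>"

lemma val_simps [simp]: "val [] = \<one>" "val (s # w) = s \<otimes> val w"
  by (simp_all add: val_def)

text \<open>The flag \<open>b = even (length u)\<close> is the class expected after
  \<open>u\<close>: \<open>b\<close> itself after an even number of syllables, the other one after
  an odd number.\<close>

lemma alternating_append [simp]:
  "alternating b (u @ v) \<longleftrightarrow> alternating b u \<and> alternating (b = even (length u)) v"
proof (induction u arbitrary: b)
  case (Cons s u)
  have "((\<not> b) = even (length u)) = (b = odd (length u))" by auto
  with Cons show ?case by auto
qed simp

lemma val_closed: "alternating b w \<Longrightarrow> val w \<in> carrier M"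
  by (induction w arbitrary: b) (auto intro: one_closed m_closed S_sub)

lemma val_append_one: "alternating b w \<Longrightarrow> val (w @ [\<one>]) = val w"
  by (induction w arbitrary: b) (auto simp: r_one one_closed)

text \<open>Removes the pair of mutually inverse letters that the shift identities insert at the
  splitting point, after \<open>s\<close> and \<open>t\<close> have absorbed them.\<close>

lemma S_cancel:
  assumes "s \<in> S c" "t \<in> S c" "k \<in> S c"
  shows "(s \<otimes> inv k) \<otimes> (k \<otimes> t) = s \<otimes> t" and "(s \<otimes> k) \<otimes> (inv k \<otimes> t) = s \<otimes> t"
proof -
  have in_M: "s \<in> carrier M" "t \<in> carrier M" "k \<in> carrier M" "inv k \<in> carrier M"
    using assms by (auto simp: S_sub inv_closed)
  show "(s \<otimes> inv k) \<otimes> (k \<otimes> t) = s \<otimes> t"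
    using S_right[of k c t "s \<otimes> inv k"] assms in_M by (simp add: m_closed r_inv_cancel')
  show "(s \<otimes> k) \<otimes> (inv k \<otimes> t) = s \<otimes> t"
    using S_right[of "inv k" c t "s \<otimes> k"] assms in_M by (simp add: m_closed r_inv_cancel S_inv)
qed

text \<open>
  The induction is on the number of syllables.  The identities \<open>shift_left\<close> and
  \<open>shift_right\<close> strip off the first, respectively last, syllable of the word provided that
  it commutes past the splitting point, that is, belongs to the same subset as the syllable
  in which the word is split; if neither does, then the first and last syllables lie in the
  same subset and \<open>middle_moufang\<close> strips off both.
\<close>

lemma val_split_induct:
  assumes IH: "\<And>b u s t v. \<lbrakk>length u + length v < n; alternating b (u @ [s]); alternating b (u @ t # v)\<rbrakk>
      \<Longrightarrow> val (u @ [s]) \<otimes> val (t # v) = val (u @ (s \<otimes> t) # v)"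
    and n: "length u + length v = n"
    and us: "alternating b (u @ [s])" and ut: "alternating b (u @ t # v)"
  shows "val (u @ [s]) \<otimes> val (t # v) = val (u @ (s \<otimes> t) # v)"
proof (cases u)
  case Nil
  have "s \<in> S b" "t \<in> S b" "alternating (\<not> b) v" using us ut Nil by auto
  then show ?thesis using Nil val_closed[of "\<not> b" v]
    by (simp add: r_one S_sub S_left)
next
  \<comment> \<open>The induction hypothesis for an empty \<open>v\<close>, where the second word is
    the single syllable \<open>t\<close>.\<close>
  have append_last: "val (u @ [s]) \<otimes> t = val (u @ [s \<otimes> t])"
    if "length u < n" "alternating b (u @ [s])" "alternating b (u @ [t])" for b u s t
    using IH[of u "[]" b s t] that by (simp add: r_one S_sub)
  case (Cons k u1)
  have k: "k \<in> S b" "k \<in> carrier M" "inv k \<in> S b"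
    using us Cons by (auto simp: S_sub S_inv)
  define X where "X = val (u1 @ [s])"
  define Y where "Y = val (t # v)"
  have X: "X \<in> carrier M" "val (u @ [s]) = k \<otimes> X"
    using us Cons val_closed[of "\<not> b" "u1 @ [s]"] by (auto simp: X_def)
  have Y: "Y \<in> carrier M"
    using ut val_closed[of "b = even (length u)" "t # v"] unfolding Y_def by simp
  show ?thesis
  proof (cases "even (length u)")
    \<comment> \<open>The first syllable \<open>k\<close> lies in the subset of \<open>s\<close> and
      \<open>t\<close>. In (kX)Y = k((X k^-1)(kY)) the inserted letters are absorbed by
      \<open>s\<close> and \<open>t\<close>, and the product left inside is shorter by one
      syllable.\<close>
    case True
    then have st: "s \<in> S b" "t \<in> S b" "alternating (\<not> b) v" using us ut by auto
    have v: "val v \<in> carrier M" using val_closed st by blast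
    have 1: "X \<otimes> inv k = val (u1 @ [s \<otimes> inv k])"
      unfolding X_def using True us n st k Cons by (intro append_last[of _ "\<not> b"]) (auto simp: S_inv)
    have 2: "k \<otimes> Y = val ((k \<otimes> t) # v)"
      unfolding Y_def using k st v by (simp add: S_left)
    have "val (u1 @ [s \<otimes> inv k]) \<otimes> val ((k \<otimes> t) # v) = val (u1 @ ((s \<otimes> inv k) \<otimes> (k \<otimes> t)) # v)"
      by (rule IH[of _ _ "\<not> b"]) (use True us ut st k n Cons in \<open>auto simp: S_mult\<close>)
    then have "(X \<otimes> inv k) \<otimes> (k \<otimes> Y) = val (u1 @ (s \<otimes> t) # v)"
      using 1 2 S_cancel st k by metis
    then show ?thesis
      using shift_left[of X Y k] X Y k Cons unfolding Y_def by simp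
  next
    case odd_u: False
    then have st: "s \<in> S (\<not> b)" "t \<in> S (\<not> b)" "alternating b v" using us ut by auto
    show ?thesis
    proof (cases "even (length v)")
      \<comment> \<open>Now the last syllable \<open>m\<close> lies in the subset of
        \<open>k\<close>. Writing it as \<open>(m \<otimes> inv k) \<otimes> k\<close> splits a
        factor \<open>k\<close> off the right end of \<open>Y\<close>, so \<open>k\<close> stands at
        both outer ends and \<open>middle_moufang\<close> applies.\<close>
      case False
      then obtain v1 m where v1: "v = v1 @ [m]" by (cases v rule: rev_cases) auto
      have m: "m \<in> S b" "m \<otimes> inv k \<in> S b" "(m \<otimes> inv k) \<otimes> k = m"
        using st False v1 k by (auto simp: S_mult S_sub r_inv_cancel')
      define Y1 where "Y1 = val (t # v1 @ [m \<otimes> inv k])"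
      have "val ((t # v1) @ [m \<otimes> inv k]) \<otimes> k = val ((t # v1) @ [(m \<otimes> inv k) \<otimes> k])"
        by (rule append_last[of _ "\<not> b"]) (use n Cons v1 m st k False in auto)
      then have Y1: "Y = Y1 \<otimes> k" "Y1 \<in> carrier M"
        using m v1 st False val_closed[of "\<not> b" "t # v1 @ [m \<otimes> inv k]"] by (auto simp: Y_def Y1_def)
      have XY1: "X \<otimes> Y1 = val (u1 @ (s \<otimes> t) # v1 @ [m \<otimes> inv k])"
        unfolding X_def Y1_def
        by (rule IH[of _ _ "\<not> b"]) (use n Cons v1 m st k us ut False odd_u in auto)
      have Z: "(X \<otimes> Y1) \<otimes> k = val (u1 @ (s \<otimes> t) # v)"
      proof -
        have "val ((u1 @ (s \<otimes> t) # v1) @ [m \<otimes> inv k]) \<otimes> k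
            = val ((u1 @ (s \<otimes> t) # v1) @ [(m \<otimes> inv k) \<otimes> k])"
          by (rule append_last[of _ "\<not> b"]) (use n Cons v1 m st k us ut False odd_u in \<open>auto simp: S_mult\<close>)
        then show ?thesis using XY1 m v1 by simp
      qed
      have "(k \<otimes> X) \<otimes> (Y1 \<otimes> k) = (k \<otimes> (X \<otimes> Y1)) \<otimes> k"
        using middle_moufang X k Y1 by simp
      also have "\<dots> = k \<otimes> ((X \<otimes> Y1) \<otimes> k)"
        using flexible X k Y1 by (simp add: m_closed)
      finally show ?thesis using Z X Y1 Cons unfolding Y_def by simp
    next
      case even_v: True
      \<comment> \<open>Here the word in front may have \<open>n\<close> syllables, just beyond the
        reach of \<open>append_last\<close>. Pulling out its first syllable \<open>k\<close>
        shortens the problem: its last syllable \<open>l\<close> absorbs \<open>inv k\<close>, and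
        \<open>[k, m]\<close> serves as the second word.\<close>
      have last: "val u' \<otimes> m = val (u' @ [m])"
        if u': "odd (length u')" "length u' \<le> n" "alternating b (u' @ [m])" for u' m
      proof -
        obtain k u1 where u1: "u' = k # u1" using u' by (cases u') auto
        have k: "k \<in> S b" "k \<in> carrier M" "inv k \<in> S b"
          using u' u1 by (auto simp: S_sub S_inv)
        have m: "m \<in> S (\<not> b)" "m \<in> carrier M" using u' by (auto simp: S_sub)
        show ?thesis
        proof (cases u1 rule: rev_cases)
          case Nil
          then show ?thesis using u1 k m by (simp add: r_one)
        next
          case (snoc u2 l)
          have l: "l \<in> S b" "alternating (\<not> b) u2" "odd (length u2)" using u' u1 snoc by auto
          have lk: "l \<otimes> inv k \<in> S b" "(l \<otimes> inv k) \<otimes> k = l"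
            using l k by (auto simp: S_mult S_sub r_inv_cancel')
          have V: "val u1 \<in> carrier M" using u' u1 val_closed[of "\<not> b" u1] by simp
          have 1: "val u1 \<otimes> inv k = val (u2 @ [l \<otimes> inv k])"
            unfolding snoc
            by (rule append_last[of _ "\<not> b"])
              (use snoc u' u1 l k in auto)
          have 2: "val (u2 @ [l \<otimes> inv k]) \<otimes> val [k, m] = val (u2 @ ((l \<otimes> inv k) \<otimes> k) # [m])"
            by (rule IH[of _ _ "\<not> b"]) (use snoc u' u1 l k m lk in auto)
          have "(val u1 \<otimes> inv k) \<otimes> (k \<otimes> m) = val (u1 @ [m])"
            using 1 2 lk snoc m by (simp add: r_one)
          then show ?thesis using shift_left[of "val u1" m k] V k m u1 by simp
        qed
      qed
      show ?thesis
      proof (cases v rule: rev_cases)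
        case Nil
        have "val u \<otimes> s = val (u @ [s])" "val u \<otimes> (s \<otimes> t) = val (u @ [s \<otimes> t])"
          using Nil n us ut st odd_u by (auto intro!: last simp: S_mult)
        moreover have "val u \<in> carrier M" using us val_closed[of b u] by simp
        ultimately show ?thesis using S_right[of s "\<not> b" t "val u"] st Nil
          by (simp add: r_one S_sub)
      next
        case (snoc v1 m)
        then have v1: "odd (length v1)" using even_v by simp
        have m: "m \<in> S (\<not> b)" "m \<in> carrier M" "inv m \<in> S (\<not> b)"
          using st snoc v1 by (auto simp: S_sub S_inv)
        define Y0 where "Y0 = val (t # v1)"
        have Y0_alt: "alternating (\<not> b) (t # v1)" using st snoc by simp
        then have Y0: "Y0 \<in> carrier M" unfolding Y0_def by (rule val_closed)
        \<comment> \<open>The empty syllable at the end gives \<open>append_last\<close> something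
          to merge \<open>m\<close> into.\<close>
        have "val ((t # v1) @ [\<one>]) \<otimes> m = val ((t # v1) @ [\<one> \<otimes> m])"
          by (rule append_last[of _ "\<not> b"])
            (use n Cons snoc m st v1 in \<open>auto simp: S_one\<close>)
        then have Y_eq: "Y = Y0 \<otimes> m"
          using val_append_one[OF Y0_alt] m snoc unfolding Y_def Y0_def by (simp add: l_one)
        have 1: "val (u @ [s]) \<otimes> m = val (u @ [s \<otimes> m])"
          by (rule append_last[of _ b])
            (use n snoc m st v1 us odd_u in auto)
        have 2: "inv m \<otimes> Y0 = val ((inv m \<otimes> t) # v1)"
          unfolding Y0_def using S_left[of "inv m" "\<not> b" t "val v1"] m st snoc val_closed[of b v1] by simp
        have 3: "val (u @ [s \<otimes> m]) \<otimes> val ((inv m \<otimes> t) # v1) = val (u @ ((s \<otimes> m) \<otimes> (inv m \<otimes> t)) # v1)"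
          by (rule IH[of _ _ b]) (use n snoc m st v1 us ut odd_u in \<open>auto simp: S_mult\<close>)
        have 4: "val (u @ (s \<otimes> t) # v1) \<otimes> m = val ((u @ (s \<otimes> t) # v1) @ [m])"
          by (rule last) (use n snoc m st v1 us ut odd_u in \<open>auto simp: S_mult\<close>)
        \<comment> \<open>The last syllable \<open>m\<close> is in the subset of \<open>s\<close>
          and \<open>t\<close>, which absorb \<open>m\<close> and \<open>inv m\<close>. Putting
          \<open>m\<close> back at the end needs \<open>last\<close>, since the word before it has
          exactly \<open>n\<close> syllables.\<close>
        have "val (u @ [s]) \<otimes> (Y0 \<otimes> m) = ((val (u @ [s]) \<otimes> m) \<otimes> (inv m \<otimes> Y0)) \<otimes> m"
          by (rule shift_right) (use Y0 m val_closed[OF us] in auto)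
        also have "\<dots> = val (u @ (s \<otimes> t) # v)"
          using 1 2 3 4 S_cancel(2)[of s "\<not> b" t m] st m snoc by simp
        finally show ?thesis using Y_eq unfolding Y_def by simp
      qed
    qed
  qed
qed

text \<open>Induction on the total length discharges the hypothesis of
  \<open>val_split_induct\<close>. Associativity on \<open>span\<close> rests on this removal of the
  bracket between two matching words.\<close>

lemma val_split:
  assumes "alternating b (u @ [s])" "alternating b (u @ t # v)"
  shows "val (u @ [s]) \<otimes> val (t # v) = val (u @ (s \<otimes> t) # v)"
  using assms
proof (induction "length u + length v" arbitrary: b u s t v rule: less_induct)
  case less
  show ?case
    by (rule val_split_induct[OF _ HOL.refl less.prems]) (rule less.hyps)
qed

section \<open>The words form a group\<close>

definition span :: "'a set" where
  "span = {val w |w. alternating True w}"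

lemma span_closed: "z \<in> span \<Longrightarrow> z \<in> carrier M"
  using val_closed by (auto simp: span_def)

lemma span_one: "\<one> \<in> span"
  unfolding span_def by (auto intro!: exI[of _ "[]"])

text \<open>An identity syllable in front makes a word nonempty or changes the subset in which it
  starts, so words can always be aligned for \<open>val_split\<close>.\<close>

lemma span_word:
  assumes "z \<in> span"
  obtains s w where "alternating c (s # w)" "z = val (s # w)"
proof -
  obtain w where w: "alternating True w" "z = val w" using assms by (auto simp: span_def)
  show thesis
  proof (cases "c \<or> w = []")
    case True
    show thesis
    proof (cases w)
      case Nil
      then show thesis using that[of \<one> "[]"] w by (simp add: S_one l_one one_closed)
    next
      case (Cons s w')
      then show thesis using that[of s w'] w True by auto
    qed
  next
    case False
    then show thesis using that[of \<one> w] w val_closed[OF w(1)] by (simp add: S_one l_one)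
  qed
qed

lemma val_in_span: "alternating c w \<Longrightarrow> val w \<in> span"
proof (cases c)
  case False
  assume w: "alternating c w"
  then have "alternating True (\<one> # w)" "val (\<one> # w) = val w"
    using False val_closed[OF w] by (auto simp: S_one l_one)
  then show ?thesis unfolding span_def by (intro CollectI exI[of _ "\<one> # w"]) simp
qed (auto simp: span_def)

lemma S_in_span: "s \<in> S c \<Longrightarrow> s \<in> span"
  using val_in_span[of c "[s]"] by (simp add: r_one S_sub)

text \<open>Represent \<open>z\<close> by a word starting in the subset opposite to
  \<open>s\<close>, and \<open>z'\<close> by one starting where that word ends. Then
  \<open>val_split\<close> evaluates both products to the same merged word, with \<open>s\<close> in
  front.\<close>

lemma letter_assoc:
  assumes s: "s \<in> S c" and z: "z \<in> span" "z' \<in> span"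
  shows "(s \<otimes> z) \<otimes> z' = s \<otimes> (z \<otimes> z')" and "s \<otimes> z \<in> span"
proof -
  obtain q0 u0 where u0: "alternating (\<not> c) (q0 # u0)" "z = val (q0 # u0)"
    using span_word[OF z(1)] .
  then obtain u q where u: "q0 # u0 = u @ [q]" by (metis list.distinct(1) rev_exhaust)
  \<comment> \<open>The subset containing the last syllable \<open>q\<close> of \<open>z\<close>,
    where the word for \<open>z'\<close> has to begin.\<close>
  define d where "d = ((\<not> c) = even (length u))"
  obtain r v where v: "alternating d (r # v)" "z' = val (r # v)"
    using span_word[OF z(2)] .
  have uq: "alternating (\<not> c) (u @ [q])" "z = val (u @ [q])" using u u0 by auto
  have ur: "alternating (\<not> c) (u @ r # v)"
    using uq v unfolding d_def by (simp del: alternating.simps)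
  have zz': "z \<otimes> z' = val (u @ (q \<otimes> r) # v)" using val_split[OF uq(1) ur] uq v by simp
  have "alternating c ((s # u) @ [q])" "alternating c ((s # u) @ r # v)"
    using uq ur s by (auto)
  from val_split[OF this] have "(s \<otimes> z) \<otimes> z' = val ((s # u) @ (q \<otimes> r) # v)"
    using uq v by simp
  then show "(s \<otimes> z) \<otimes> z' = s \<otimes> (z \<otimes> z')" using zz' by simp
  show "s \<otimes> z \<in> span" using val_in_span[of c "s # u @ [q]"] s uq by simp
qed

lemma span_induct [consumes 1, case_names one letter]:
  assumes "z \<in> span" "P \<one>" "\<And>s c z. \<lbrakk>s \<in> S c; z \<in> span; P z\<rbrakk> \<Longrightarrow> P (s \<otimes> z)"
  shows "P z"
proof -
  have "P (val w)" if "alternating c w" for c w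
    using that
  proof (induction w arbitrary: c)
    case (Cons s w)
    then have "s \<in> S c" "alternating (\<not> c) w" "P (val w)" by auto
    then show ?case using assms(3) val_in_span by simp
  qed (simp add: assms)
  then show ?thesis using assms(1) by (auto simp: span_def)
qed

lemma span_mult:
  assumes "u \<in> span" "z \<in> span"
  shows "u \<otimes> z \<in> span"
  using assms(1)
proof (induction u rule: span_induct)
  case one
  then show ?case using assms by (simp add: l_one span_closed)
next
  case (letter s c u)
  then show ?case using letter_assoc assms(2) by simp
qed

lemma span_assoc:
  assumes "u \<in> span" "v \<in> span" "z \<in> span"
  shows "(u \<otimes> v) \<otimes> z = u \<otimes> (v \<otimes> z)"
  using assms(1)
proof (induction u rule: span_induct)
  case one
  then show ?case using assms by (simp add: l_one span_closed span_mult)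
next
  case (letter s c u)
  then show ?case using assms by (simp add: letter_assoc span_mult)
qed

lemma span_inv:
  assumes "u \<in> span"
  shows "inv u \<in> span"
  using assms
proof (induction u rule: span_induct)
  case one
  then show ?case by (simp add: inv_one span_one)
next
  case (letter s c u)
  then have "inv s \<in> span" using S_in_span S_inv by blast
  with letter show ?case by (simp add: inv_mult S_sub span_closed span_mult)
qed

lemma group_span: "group (M\<lparr>carrier := span\<rparr>)"
proof (rule groupI; clarsimp)
  show "\<one> \<in> span" by (rule span_one)
  show "x \<otimes> y \<in> span" if "x \<in> span" "y \<in> span" for x y
    using that by (rule span_mult)
  show "(x \<otimes> y) \<otimes> z = x \<otimes> (y \<otimes> z)" if "x \<in> span" "y \<in> span" "z \<in> span" for x y z
    using that by (rule span_assoc)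
  show "\<one> \<otimes> x = x" if "x \<in> span" for x
    using that by (simp add: l_one span_closed)
  show "\<exists>y\<in>span. y \<otimes> x = \<one>" if "x \<in> span" for x
    using that by (intro bexI[of _ "inv x"]) (simp_all add: l_inv span_inv span_closed)
qed

end

section \<open>Groups of prime power order with at most one subgroup of prime order\<close>

text \<open>With r = 1 + pt, each r^k is 1 + kpt modulo p^2. The sum is therefore p + pt(0 + ... +
  (p - 1)), and for odd \<open>p\<close> the inner sum is a multiple of \<open>p\<close>, so the
  total is \<open>p\<close> modulo p^2.\<close>

lemma geometric_sum_prime:
  fixes r :: int
  assumes p: "prime p" "p \<noteq> 2" and r: "int p dvd r - 1"
  obtains u where "(\<Sum>k<p. r ^ k) = int p * u" "\<not> int p dvd u"
proof -
  obtain t where t: "r = 1 + int p * t" using r by (auto simp: dvd_def algebra_simps)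
  have pow_r: "(int p)\<^sup>2 dvd r ^ k - (1 + int k * int p * t)" for k
  proof (induction k)
    case (Suc k)
    then obtain q where "r ^ k = 1 + int k * int p * t + (int p)\<^sup>2 * q"
      by (auto simp: dvd_def algebra_simps)
    then have "r ^ Suc k - (1 + int (Suc k) * int p * t) = (int p)\<^sup>2 * (q * r + int k * t * t)"
      by (simp add: t algebra_simps power2_eq_square)
    then show ?case by simp
  qed simp
  have "(int p)\<^sup>2 dvd (\<Sum>k<p. r ^ k - (1 + int k * int p * t))"
    using pow_r by (intro dvd_sum) auto
  also have "(\<Sum>k<p. r ^ k - (1 + int k * int p * t)) = (\<Sum>k<p. r ^ k) - (int p + (\<Sum>k<p. int k) * (int p * t))"
    by (simp add: sum_subtractf sum.distrib sum_distrib_right mult.assoc)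
  finally have S: "(int p)\<^sup>2 dvd (\<Sum>k<p. r ^ k) - (int p + (\<Sum>k<p. int k) * (int p * t))" .
  have "2 * (\<Sum>k<n. int k) = int n * (int n - 1)" for n
    by (induction n) (auto simp: algebra_simps)
  then have "int p dvd 2 * (\<Sum>k<p. int k)" by simp
  moreover have "\<not> int p dvd 2"
    using p primes_dvd_imp_eq[of p 2] by (metis int_dvd_int_iff of_nat_numeral two_is_prime_nat)
  ultimately have "int p dvd (\<Sum>k<p. int k)"
    using p(1) prime_dvd_mult_int[of "int p"] by simp
  then obtain w where "(\<Sum>k<p. int k) = int p * w" by (auto simp: dvd_def)
  with S obtain q where "(\<Sum>k<p. r ^ k) = int p * (1 + int p * (w * t + q))"
    by (auto simp: dvd_def algebra_simps power2_eq_square)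
  moreover have "\<not> int p dvd 1 + int p * (w * t + q)"
    using p(1) by (simp add: dvd_add_left_iff prime_nat_iff)
  ultimately show thesis using that by blast
qed

text \<open>Here \<open>N\<close> is the order of \<open>a\<close>, \<open>b\<close> acts on
  \<open>a\<close> by the exponent \<open>r\<close>, and b^2 = a^(2j); the hypotheses on
  \<open>j\<close> say that b^2 and (ba)^2 are nontrivial. As (r - 1)/2 is odd, it cancels modulo
  \<open>N\<close>, so r + 1 and 2j are multiples of N/2. Nontriviality makes 2j an odd multiple and
  then r + 1 an even one.\<close>

lemma quaternion_exponents:
  fixes r j :: int
  assumes N: "N = 2 ^ m" "m \<ge> 1"
    and r: "N dvd r ^ 2 - 1" "\<not> 4 dvd r - 1" and rj: "N dvd 2 * j * (r - 1)"
    and j: "\<not> N dvd 2 * j" "\<not> N dvd 2 * j + (r + 1)"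
  shows "N dvd r + 1" "\<exists>k\<ge>1. N = 2 * 2 ^ k \<and> N dvd 2 * j - 2 ^ k"
proof -
  obtain n where m: "m = Suc n" using N(2) by (cases m) auto
  define h :: int where "h = 2 ^ n"
  have N': "N = 2 * h" by (simp add: N m h_def)
  have "odd r"
  proof
    assume "even r"
    then have "odd (r ^ 2 - 1)" by simp
    then show False using r(1) N' by (metis dvd_trans dvd_triv_left)
  qed
  then obtain q where "r = 2 * q + 1" by (auto elim: oddE)
  then have "odd q" using r(2) by auto
  with \<open>r = 2 * q + 1\<close> have r1: "r - 1 = 2 * q" by simp
  have "coprime N q" using \<open>odd q\<close> N by (simp add: coprime_left_2_iff_odd)
  have "N dvd q * (2 * (r + 1))"
    using r(1) r1 by (simp add: power2_eq_square algebra_simps)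
  then have "2 * h dvd 2 * (r + 1)"
    using \<open>coprime N q\<close> N' coprime_dvd_mult_right_iff by blast
  then have "h dvd r + 1" by (subst (asm) dvd_times_left_cancel_iff) auto
  then obtain e where e: "r + 1 = h * e" by (auto simp: dvd_def)
  have "N dvd q * (2 * (2 * j))" using rj r1 by (simp add: algebra_simps)
  then have "2 * h dvd 2 * (2 * j)"
    using \<open>coprime N q\<close> N' coprime_dvd_mult_right_iff by blast
  then have "h dvd 2 * j" by (subst (asm) dvd_times_left_cancel_iff) auto
  then obtain f where f: "2 * j = h * f" by (auto simp: dvd_def)
  have h0: "h \<noteq> 0" by (simp add: h_def)
  have N_iff: "N dvd h * x \<longleftrightarrow> even x" for x
    using h0 N' by (simp add: mult.commute[of 2 h])
  have "odd f" using j(1) f N_iff by simp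
  have "2 * j + (r + 1) = h * (f + e)" using e f by (simp add: algebra_simps)
  then have "even e" using j(2) N_iff \<open>odd f\<close> by simp
  then show "N dvd r + 1" using e N_iff by simp
  have "2 * j - h = h * (f - 1)" using f by (simp add: algebra_simps)
  then have "N dvd 2 * j - h" using N_iff \<open>odd f\<close> by simp
  \<comment> \<open>For n = 0 the modulus would be 2, which divides 2j.\<close>
  moreover have "n \<ge> 1"
    using j(1) N' h_def by (cases n) auto
  ultimately show "\<exists>k\<ge>1. N = 2 * 2 ^ k \<and> N dvd 2 * j - 2 ^ k"
    using N' h_def by auto
qed

section \<open>Powers, conjugation and central elements in groups\<close>

context group
begin

lemma inv_cancel_left:
  assumes "x \<in> carrier G" "y \<in> carrier G"
  shows "inv x \<otimes> (x \<otimes> y) = y" and "x \<otimes> (inv x \<otimes> y) = y"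
  using assms by (simp_all flip: m_assoc)

lemmas word_simps = m_assoc inv_cancel_left inv_mult_group

abbreviation powers :: "'a \<Rightarrow> 'a set" where
  "powers a \<equiv> range (\<lambda>i::int. a [^] i)"

lemma powers_self: "a \<in> carrier G \<Longrightarrow> a \<in> powers a"
  using int_pow_1 by (metis rangeI)

lemma powers_eq_generate: "a \<in> carrier G \<Longrightarrow> powers a = generate G {a}"
  by (auto simp: generate_pow)

lemma card_powers: "a \<in> carrier G \<Longrightarrow> card (powers a) = ord a"
  by (simp add: powers_eq_generate generate_pow_card)

lemma powers_mono:
  assumes "b \<in> powers a" "a \<in> carrier G"
  shows "powers b \<subseteq> powers a"
  using assms by (auto simp: int_pow_pow)

lemma powers_cancel:
  assumes "a \<in> carrier G" "b \<in> carrier G" "b \<otimes> a [^] (i::int) = a [^] (l::int)"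
  shows "b = a [^] (l - i)"
proof -
  have "b = b \<otimes> a [^] i \<otimes> inv (a [^] i)" using assms(1,2) by (simp add: m_assoc)
  also have "\<dots> = a [^] (l - i)" using assms by (simp add: int_pow_diff)
  finally show ?thesis .
qed

text \<open>Conjugation by \<open>b\<close> is an endomorphism taking \<open>a\<close> to
  \<open>c\<close>, hence powers of \<open>a\<close> to powers of \<open>c\<close>.\<close>

lemma conj_int_pow:
  assumes "a \<in> carrier G" "b \<in> carrier G" "c \<in> carrier G" "a \<otimes> b = b \<otimes> c"
  shows "a [^] (i::int) \<otimes> b = b \<otimes> c [^] i"
proof -
  let ?h = "\<lambda>x. inv b \<otimes> x \<otimes> b"
  have "?h (x \<otimes> y) = ?h x \<otimes> ?h y" if "x \<in> carrier G" "y \<in> carrier G" for x y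
  proof -
    have "?h x \<otimes> ?h y = inv b \<otimes> x \<otimes> (b \<otimes> (inv b \<otimes> y)) \<otimes> b"
      using that assms by (simp add: m_assoc)
    also have "b \<otimes> (inv b \<otimes> y) = y" using that assms by (simp add: m_assoc[symmetric])
    finally show ?thesis using that assms by (simp add: m_assoc)
  qed
  then have "?h \<in> hom G G" using assms by (auto simp: hom_def)
  then have "?h (a [^] i) = ?h a [^] i"
    using assms by (intro hom_int_pow) auto
  also have "?h a = c" using assms by (simp add: m_assoc) (simp flip: m_assoc)
  finally show ?thesis
    using assms by (metis inv_closed int_pow_closed inv_solve_left m_assoc m_closed)
qed

lemma conj_iterate:
  assumes "a \<in> carrier G" "b \<in> carrier G" "a \<otimes> b = b \<otimes> a [^] (r::int)"
  shows "a \<otimes> b [^] n = b [^] n \<otimes> a [^] (r ^ n)"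
proof (induction n)
  case (Suc n)
  have "a \<otimes> b [^] Suc n = b [^] n \<otimes> (a [^] (r ^ n) \<otimes> b)"
    using assms Suc by (simp flip: m_assoc)
  also have "\<dots> = b [^] n \<otimes> (b \<otimes> (a [^] r) [^] (r ^ n))"
    using assms by (subst conj_int_pow[of a b "a [^] r"]) auto
  also have "\<dots> = b [^] Suc n \<otimes> a [^] (r ^ Suc n)"
    using assms by (simp add: int_pow_pow m_assoc)
  finally show ?case .
qed (use assms in auto)

text \<open>Moving one more \<open>b\<close> to the left past the accumulated power of
  \<open>a\<close> multiplies its exponent by \<open>r\<close>, which builds up the geometric
  sum.\<close>

lemma twisted_power:
  assumes "a \<in> carrier G" "b \<in> carrier G" "a \<otimes> b = b \<otimes> a [^] (r::int)"
  shows "(b \<otimes> a [^] i) [^] n = b [^] n \<otimes> a [^] (i * (\<Sum>k<n. r ^ k))"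
proof (induction n)
  case (Suc n)
  let ?S = "\<Sum>k<n. r ^ k"
  have "(b \<otimes> a [^] i) [^] Suc n = b [^] n \<otimes> (a [^] (i * ?S) \<otimes> b) \<otimes> a [^] i"
    using assms Suc by (simp add: m_assoc)
  also have "a [^] (i * ?S) \<otimes> b = b \<otimes> (a [^] r) [^] (i * ?S)"
    using assms by (intro conj_int_pow) auto
  also have "b [^] n \<otimes> (b \<otimes> (a [^] r) [^] (i * ?S)) \<otimes> a [^] i
      = b [^] Suc n \<otimes> a [^] (r * (i * ?S) + i)"
    using assms by (simp add: int_pow_pow int_pow_mult m_assoc)
  also have "r * (i * ?S) + i = i * (\<Sum>k<Suc n. r ^ k)"
    by (simp only: sum.lessThan_Suc_shift) (simp add: sum_distrib_left algebra_simps)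
  finally show ?case .
qed simp

lemma normal_powers_conj:
  assumes "powers a \<lhd> G" "a \<in> carrier G" "g \<in> carrier G"
  obtains r :: int where "a \<otimes> g = g \<otimes> a [^] r"
proof -
  have "inv g \<otimes> a \<otimes> g \<in> powers a"
    using normal.inv_op_closed1[OF assms(1,3) powers_self[OF assms(2)]] .
  then obtain r :: int where "inv g \<otimes> a \<otimes> g = a [^] r" by blast
  then have "g \<otimes> a [^] r = g \<otimes> (inv g \<otimes> a \<otimes> g)" by simp
  also have "\<dots> = a \<otimes> g" using assms(2,3) by (simp add: word_simps)
  finally show thesis using that[of r] by simp
qed

text \<open>The class equation inside \<open>N\<close>: without a nontrivial central element, every
  conjugacy class in \<open>N - {\<one>}\<close> has size a positive power of \<open>p\<close>. Then
  \<open>p\<close> divides both \<open>card N\<close> and \<open>card N - 1\<close>.\<close>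

lemma normal_meets_center:
  assumes p: "prime p" "order G = p ^ k" and N: "N \<lhd> G" "N \<noteq> {\<one>}"
  obtains z where "z \<in> N" "z \<noteq> \<one>" "\<And>g. g \<in> carrier G \<Longrightarrow> g \<otimes> z = z \<otimes> g"
proof (rule ccontr)
  note central = that
  assume no_central: "\<not> thesis"
  have moved: "\<exists>g\<in>carrier G. g \<otimes> z \<noteq> z \<otimes> g" if z: "z \<in> N - {\<one>}" for z
  proof (rule ccontr)
    assume "\<not> (\<exists>g\<in>carrier G. g \<otimes> z \<noteq> z \<otimes> g)"
    then have thesis using central[of z] z by blast
    with no_central show False ..
  qed
  interpret N: normal N G by fact
  define \<phi> where "\<phi> = (\<lambda>g. \<lambda>h \<in> carrier G. g \<otimes> h \<otimes> inv g)"
  interpret act: group_action G "carrier G" \<phi>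
    unfolding \<phi>_def by (rule action_by_conjugation)
  have fin: "finite (carrier G)"
    using p order_gt_0_iff_finite prime_gt_0_nat by simp
  define R where "R = {(x, y). x \<in> N - {\<one>} \<and> y \<in> orbit G \<phi> x}"
  have N_sub: "x \<in> N \<Longrightarrow> x \<in> carrier G" for x using N.subset by auto
  have orbit_eq: "orbit G \<phi> x = (\<lambda>g. g \<otimes> x \<otimes> inv g) ` carrier G" if "x \<in> N" for x
    using that N_sub by (auto simp: orbit_def \<phi>_def)
  have orbit_N: "orbit G \<phi> x \<subseteq> N - {\<one>}" if x: "x \<in> N - {\<one>}" for x
  proof
    fix y assume "y \<in> orbit G \<phi> x"
    then obtain g where g: "g \<in> carrier G" "y = g \<otimes> x \<otimes> inv g"
      using x orbit_eq by auto
    then have "y \<in> N" using N.inv_op_closed2 x by auto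
    moreover have "y \<noteq> \<one>"
      using g x N_sub conjugation_is_inj[of g x \<one>] by auto
    ultimately show "y \<in> N - {\<one>}" by simp
  qed
  have "p dvd card (N - {\<one>})"
  proof (rule equiv_imp_dvd_card)
    show "finite (N - {\<one>})" using fin N.subset finite_subset by auto
    show "equiv (N - {\<one>}) R"
    proof (rule equivI)
      show "R \<subseteq> (N - {\<one>}) \<times> (N - {\<one>})" using orbit_N by (auto simp: R_def)
      show "refl_on (N - {\<one>}) R" using act.orbit_refl N_sub by (auto simp: refl_on_def R_def)
      show "Relation.sym R"
      proof (rule symI)
        fix x y assume "(x, y) \<in> R"
        then have xy: "x \<in> N - {\<one>}" "y \<in> orbit G \<phi> x" by (auto simp: R_def)
        then have "y \<in> N - {\<one>}" using orbit_N by blast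
        then show "(y, x) \<in> R" using act.orbit_sym[of x y] xy N_sub by (simp add: R_def)
      qed
      show "Relation.trans R"
      proof (rule transI)
        fix x y z assume "(x, y) \<in> R" "(y, z) \<in> R"
        then have xyz: "x \<in> N - {\<one>}" "y \<in> orbit G \<phi> x" "z \<in> orbit G \<phi> y" "y \<in> N - {\<one>}"
          by (auto simp: R_def)
        then have "z \<in> N" using orbit_N by blast
        then show "(x, z) \<in> R"
          using act.orbit_trans[of x y z] xyz N_sub by (auto simp: R_def)
      qed
    qed
    show "p dvd card X" if "X \<in> (N - {\<one>}) // R" for X
    proof -
      obtain x where x: "x \<in> N - {\<one>}" "X = orbit G \<phi> x"
        using \<open>X \<in> _\<close> by (auto simp: quotient_def R_def)
      have "card X dvd p ^ k"
        using act.orbit_stabilizer_theorem[of x] x N_sub p(2) by (metis DiffD1 dvd_triv_left)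
      then obtain i where i: "card X = p ^ i"
        using p(1) divides_primepow_nat by blast
      have "i \<noteq> 0"
      proof
        assume "i = 0"
        then obtain w where w: "X = {w}" using i card_1_singletonE by auto
        have xX: "x \<in> X" using act.orbit_refl x N_sub by auto
        obtain g where g: "g \<in> carrier G" "g \<otimes> x \<noteq> x \<otimes> g" using moved x(1) by blast
        then have "g \<otimes> x \<otimes> inv g \<in> X"
          using x orbit_eq by auto
        then have "g \<otimes> x \<otimes> inv g = x" using xX w by auto
        then show False using g x N_sub by (metis DiffD1 inv_solve_right m_closed)
      qed
      then show ?thesis using i by simp
    qed
  qed
  moreover have "p dvd card N"
  proof -
    have "card N dvd p ^ k"
      using lagrange[OF N.subgroup_axioms] p(2) by (metis dvd_triv_right)
    then obtain i where i: "card N = p ^ i"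
      using p(1) divides_primepow_nat by blast
    have "i \<noteq> 0"
    proof
      assume "i = 0"
      then obtain w where "N = {w}" using i card_1_singletonE by auto
      then show False using N(2) N.one_closed by auto
    qed
    then show ?thesis using i by simp
  qed
  moreover have "card N = Suc (card (N - {\<one>}))"
    using fin N.subset N.one_closed finite_subset by (metis card.remove)
  ultimately have "p dvd 1" by (metis Suc_eq_plus1 dvd_add_right_iff)
  then show False using p(1) by auto
qed

end

section \<open>The structure of p-groups with at most one subgroup of order p\<close>

locale unique_order_p_group = group +
  fixes p k :: nat
  assumes prime_p: "prime p"
    and order_G: "order G = p ^ k"
    and subgroup_unique: "\<lbrakk>subgroup H G; card H = p; subgroup K G; card K = p\<rbrakk> \<Longrightarrow> H = K"
begin

lemma finite_G: "finite (carrier G)"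
  using order_G order_gt_0_iff_finite prime_gt_0_nat[OF prime_p] by simp

lemma ord_prime_power:
  assumes "a \<in> carrier G"
  obtains m where "ord a = p ^ m"
  using assms ord_dvd_group_order order_G prime_p divides_primepow_nat by metis

text \<open>The cyclic group of a nontrivial \<open>a\<close> contains an element \<open>z\<close>
  of order \<open>p\<close>; by uniqueness \<open>z\<close> and a nontrivial \<open>y\<close>
  generate the same subgroup.\<close>

lemma order_p_in_powers:
  assumes a: "a \<in> carrier G" "a \<noteq> \<one>" and y: "y \<in> carrier G" "y [^] p = \<one>"
  shows "y \<in> powers a"
proof (cases "y = \<one>")
  case True
  then show ?thesis by (metis int_pow_0 rangeI)
next
  case False
  obtain m where m: "ord a = p ^ m" using ord_prime_power a by blast
  have "m \<noteq> 0" using m a ord_eq_1 by fastforce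
  then obtain n where n: "m = Suc n" by (cases m) auto
  define z where "z = a [^] (p ^ n)"
  have z: "z \<in> carrier G" "z \<in> powers a"
    using a unfolding z_def by (auto simp flip: int_pow_int)
  have "ord z = p"
    unfolding z_def using ord_pow[of a "p ^ n"] a m n prime_gt_0_nat[OF prime_p] by simp
  moreover have "ord y = p"
    using y False prime_p pow_eq_id ord_eq_1 by (metis prime_nat_iff)
  ultimately have "powers y = powers z"
    using z y by (intro subgroup_unique) (auto simp: subgroup_of_powers card_powers)
  then show ?thesis using powers_self[OF y(1)] powers_mono[OF z(2) a(1)] by auto
qed

text \<open>Since \<open>u\<close> is invertible modulo the order of \<open>a\<close>, with inverse
  \<open>v\<close>, the exponent i = -jv gives (b a^i)^p = 1. By \<open>order_p_in_powers\<close>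
  the element b a^i lies in \<open>powers a\<close>, and so does \<open>b\<close>.\<close>

lemma root_in_powers:
  assumes a: "a \<in> carrier G" "a \<noteq> \<one>" and b: "b \<in> carrier G"
    and conj: "a \<otimes> b = b \<otimes> a [^] (r::int)" and bp: "b [^] p = a [^] (int p * j)"
    and S: "(\<Sum>k<p. r ^ k) = int p * u" "\<not> int p dvd u"
  shows "b \<in> powers a"
proof -
  obtain m where m: "ord a = p ^ m" using ord_prime_power a by blast
  have "coprime u (int p ^ m)"
    using S(2) prime_p prime_imp_coprime[of "int p" u] by (simp add: coprime_commute)
  then obtain v where "[u * v = 1] (mod int p ^ m)" using cong_solve_coprime_int by blast
  then have v: "int (ord a) dvd u * v - 1" using m by (simp add: cong_iff_dvd_diff)
  define i where "i = - (j * v)"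
  have "(b \<otimes> a [^] i) [^] p = a [^] (int p * j) \<otimes> a [^] (i * (int p * u))"
    using twisted_power[OF a(1) b conj] bp S(1) by simp
  also have "\<dots> = a [^] (int p * j + i * (int p * u))" using a by (simp add: int_pow_mult)
  also have "int p * j + i * (int p * u) = - (int p * j) * (u * v - 1)"
    by (simp add: i_def algebra_simps)
  also have "a [^] \<dots> = \<one>" using v a by (subst int_pow_eq_id) auto
  finally have "(b \<otimes> a [^] i) [^] p = \<one>" .
  then obtain l :: int where "b \<otimes> a [^] i = a [^] l"
    using order_p_in_powers[OF a, of "b \<otimes> a [^] i"] a b by auto
  then have "b = a [^] (l - i)"
    using a b powers_cancel by blast
  then show ?thesis by blast
qed

text \<open>The sequence of p-th powers of \<open>x\<close> ends at the identity, so it enters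
  \<open>H\<close>; the term just before its first entry is the one wanted.\<close>

lemma last_power_outside:
  assumes H: "subgroup H G" and x: "x \<in> carrier G" "x \<notin> H"
  obtains t where "x [^] (p ^ t) \<notin> H" "(x [^] (p ^ t)) [^] p \<in> H"
proof -
  define T where "T = (LEAST t. x [^] (p ^ t) \<in> H)"
  have "x [^] (p ^ k) = \<one>" using pow_order_eq_1 x order_G by simp
  then have ex: "x [^] (p ^ k) \<in> H" using H subgroup.one_closed by simp
  then have T: "x [^] (p ^ T) \<in> H" unfolding T_def by (rule LeastI)
  have "T \<noteq> 0" using T x by (auto intro: ccontr)
  then obtain t where t: "T = Suc t" by (cases T) auto
  have "x [^] (p ^ t) \<notin> H"
    using not_less_Least[of t "\<lambda>t. x [^] (p ^ t) \<in> H"] t unfolding T_def by simp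
  then show thesis
    using that[of t] T t x by (simp add: nat_pow_pow mult.commute)
qed

text \<open>The order of \<open>a\<close> is a power of \<open>p\<close>, so \<open>i\<close> has an
  inverse \<open>v\<close> modulo it, and a = (b^p)^v.\<close>

lemma powers_of_coprime_power:
  assumes a: "a \<in> carrier G" and b: "b \<in> carrier G" "b [^] p = a [^] (i::int)" "\<not> int p dvd i"
  shows "a \<in> powers b"
proof -
  obtain m where m: "ord a = p ^ m" using ord_prime_power a by blast
  have "coprime i (int p ^ m)"
    using b(3) prime_p prime_imp_coprime[of "int p" i] by (simp add: coprime_commute)
  then obtain v where "[i * v = 1] (mod int p ^ m)" using cong_solve_coprime_int by blast
  then have "a [^] (i * v) = a [^] (1::int)"
    using m a by (subst int_pow_eq) (auto simp: cong_iff_dvd_diff dvd_diff_commute)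
  then have "a = (b [^] int p) [^] v"
    using a b by (simp add: int_pow_pow int_pow_int)
  then have "a = b [^] (int p * v)" using b by (simp add: int_pow_pow)
  then show ?thesis by blast
qed

text \<open>Take a normal \<open>powers a\<close> of maximal order. Were its centralizer larger, the
  quotient would have a nontrivial central element coming from it; a suitable power \<open>b\<close>
  of a lift has b^p in \<open>powers a\<close>. Either b^p generates \<open>powers a\<close>, and
  \<open>powers b\<close> is a larger cyclic normal subgroup, or \<open>root_in_powers\<close> puts
  \<open>b\<close> into \<open>powers a\<close>.\<close>

lemma self_centralizing_cyclic_normal:
  obtains a where "a \<in> carrier G" "powers a \<lhd> G"
    "\<And>c. c \<in> carrier G \<Longrightarrow> a \<otimes> c = c \<otimes> a \<Longrightarrow> c \<in> powers a"
proof -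
  have "powers \<one> \<lhd> G" using one_is_normal by (simp add: image_constant_conv)
  then obtain a where a: "a \<in> carrier G" "powers a \<lhd> G"
    and max: "\<And>b. b \<in> carrier G \<Longrightarrow> powers b \<lhd> G \<Longrightarrow> ord b \<le> ord a"
    using ex_has_greatest_nat[of "\<lambda>a. a \<in> carrier G \<and> powers a \<lhd> G" \<one> ord "Suc (order G)"]
      ord_le_group_order[OF finite_G] by (metis le_imp_less_Suc one_closed)
  interpret A: normal "powers a" G by (rule a)
  have "c0 \<in> powers a" if c0: "c0 \<in> carrier G" "a \<otimes> c0 = c0 \<otimes> a" for c0
  proof (rule ccontr)
    assume out: "c0 \<notin> powers a"
    define C where "C = {c \<in> carrier G. a \<otimes> c = c \<otimes> a}"
    have comm: "a [^] (i::int) \<otimes> c = c \<otimes> a [^] i" if "c \<in> C" for c i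
      using that a(1) unfolding C_def by (intro conj_int_pow) auto
    have C: "C \<lhd> G"
      unfolding normal_inv_iff
    proof (intro conjI ballI)
      show "subgroup C G"
      proof
        show "C \<subseteq> carrier G" by (auto simp: C_def)
        show "\<one> \<in> C" using a by (simp add: C_def)
        show "x \<otimes> y \<in> C" if "x \<in> C" "y \<in> C" for x y
          using that a unfolding C_def by (simp flip: m_assoc) (simp add: m_assoc)
        show "inv x \<in> C" if "x \<in> C" for x
          using that a unfolding C_def
          by (metis (mono_tags, lifting) inv_closed inv_solve_left inv_solve_right m_assoc m_closed mem_Collect_eq)
      qed
      fix g c assume gc: "g \<in> carrier G" "c \<in> C"
      then have c: "c \<in> carrier G" by (simp add: C_def)
      obtain i :: int where i: "a \<otimes> g = g \<otimes> a [^] i"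
        using normal_powers_conj[OF a(2,1), of g] gc by auto
      have "a \<otimes> (g \<otimes> c \<otimes> inv g) = a \<otimes> g \<otimes> c \<otimes> inv g"
        using a gc c by (simp add: m_assoc)
      also have "\<dots> = g \<otimes> (a [^] i \<otimes> c) \<otimes> inv g"
        unfolding i using a gc c by (simp add: m_assoc)
      also have "\<dots> = g \<otimes> c \<otimes> (a [^] i \<otimes> inv g)"
        using comm gc a c by (simp add: m_assoc)
      also have "a [^] i = inv g \<otimes> (a \<otimes> g)"
        using i a gc by (simp add: word_simps)
      also have "inv g \<otimes> (a \<otimes> g) \<otimes> inv g = inv g \<otimes> a"
        using a gc by (simp add: word_simps)
      finally have "a \<otimes> (g \<otimes> c \<otimes> inv g) = g \<otimes> c \<otimes> inv g \<otimes> a"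
        using gc a c by (simp add: word_simps)
      then show "g \<otimes> c \<otimes> inv g \<in> C" using gc c by (simp add: C_def)
    qed
    interpret Q: group "G Mod powers a" by (rule A.factorgroup_is_group)
    let ?\<pi> = "\<lambda>x. powers a #> x"
    have hom: "group_hom G (G Mod powers a) ?\<pi>"
      by unfold_locales (rule A.r_coset_hom_Mod)
    have "?\<pi> ` C \<lhd> G Mod powers a"
      by (rule normal.surj_hom_normal_subgroup[OF C hom]) (auto simp: FactGroup_def RCOSETS_def)
    moreover have "?\<pi> c0 \<in> ?\<pi> ` C" "?\<pi> c0 \<noteq> \<one>\<^bsub>G Mod powers a\<^esub>"
      using c0 out rcos_self[of c0 "powers a"] A.subgroup_axioms by (auto simp: C_def FactGroup_def)
    then have "?\<pi> ` C \<noteq> {\<one>\<^bsub>G Mod powers a\<^esub>}" by blast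
    moreover have "order (G Mod powers a) dvd p ^ k"
      using lagrange[OF A.subgroup_axioms] order_G
      by (simp add: FactGroup_def order_def) (metis dvd_triv_left)
    then obtain i where "order (G Mod powers a) = p ^ i"
      using prime_p divides_primepow_nat by blast
    ultimately obtain Z where Z: "Z \<in> ?\<pi> ` C" "Z \<noteq> \<one>\<^bsub>G Mod powers a\<^esub>"
      "\<And>X. X \<in> carrier (G Mod powers a) \<Longrightarrow> X \<otimes>\<^bsub>G Mod powers a\<^esub> Z = Z \<otimes>\<^bsub>G Mod powers a\<^esub> X"
      using Q.normal_meets_center[OF prime_p] by metis
    then obtain c where c: "c \<in> C" "c \<in> carrier G" "Z = ?\<pi> c" by (auto simp: C_def)
    have c_out: "c \<notin> powers a"
      using Z(2) c(3) A.rcos_const[of c] by (auto simp: FactGroup_def)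
    obtain t where t: "c [^] (p ^ t) \<notin> powers a" "(c [^] (p ^ t)) [^] p \<in> powers a"
      using last_power_outside[OF A.subgroup_axioms c(2) c_out] by metis
    define b where "b = c [^] (p ^ t)"
    have b: "b \<in> carrier G" "b \<notin> powers a" using t c by (auto simp: b_def)
    have b_comm: "a \<otimes> b = b \<otimes> a"
      using group_commutes_pow[of c a "p ^ t"] c a unfolding b_def C_def by auto
    \<comment> \<open>The coset of \<open>c\<close>, hence that of its power \<open>b\<close>, is
      central in the quotient. This will make \<open>powers b\<close> normal as soon as it contains
      \<open>a\<close>.\<close>
    have b_conj: "\<exists>i::int. g \<otimes> b \<otimes> inv g = a [^] i \<otimes> b" if g: "g \<in> carrier G" for g
    proof -
      have "?\<pi> (g \<otimes> c) = ?\<pi> (c \<otimes> g)"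
        using Z(3)[of "?\<pi> g"] c g A.rcos_sum by (auto simp: FactGroup_def RCOSETS_def)
      then have "g \<otimes> c \<in> ?\<pi> (c \<otimes> g)"
        using rcos_self[of "g \<otimes> c"] c g A.subgroup_axioms by auto
      then obtain i :: int where "g \<otimes> c = a [^] i \<otimes> (c \<otimes> g)" by (auto simp: r_coset_def)
      then have i: "g \<otimes> c \<otimes> inv g = a [^] i \<otimes> c"
        using a c g by (simp add: word_simps)
      have "g \<otimes> c [^] n \<otimes> inv g = (g \<otimes> c \<otimes> inv g) [^] n" for n :: nat
      proof (induction n)
        case (Suc n)
        have "g \<otimes> c [^] Suc n \<otimes> inv g = (g \<otimes> c [^] n \<otimes> inv g) \<otimes> (g \<otimes> c \<otimes> inv g)"
          using c g by (simp add: word_simps)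
        then show ?case using Suc by simp
      qed (use g in auto)
      then have "g \<otimes> b \<otimes> inv g = (a [^] i \<otimes> c) [^] (p ^ t)" unfolding b_def using i by simp
      also have "\<dots> = (a [^] i) [^] (p ^ t) \<otimes> b"
        unfolding b_def using a c comm by (intro pow_mult_distrib) auto
      also have "(a [^] i) [^] (p ^ t) = a [^] (i * int (p ^ t))"
        using a by (simp add: int_pow_pow flip: int_pow_int)
      finally show ?thesis by blast
    qed
    obtain i :: int where i: "b [^] p = a [^] i" using t(2) unfolding b_def by blast
    have "a \<notin> powers b"
    proof
      assume "a \<in> powers b"
      then obtain l :: int where l: "a = b [^] l" by blast
      have "powers b \<lhd> G"
        unfolding normal_inv_iff
      proof (intro conjI ballI)
        show "subgroup (powers b) G" using b subgroup_of_powers by blast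
        fix g h assume g: "g \<in> carrier G" and "h \<in> powers b"
        then obtain n :: int where n: "h = b [^] n" by blast
        obtain i :: int where i: "g \<otimes> b \<otimes> inv g = a [^] i \<otimes> b" using b_conj g by blast
        define d where "d = a [^] i \<otimes> b"
        have d: "d = b [^] (l * i + 1)" using b by (simp add: d_def l int_pow_pow int_pow_mult)
        have "b \<otimes> inv g = inv g \<otimes> d"
          using i b g unfolding d_def[symmetric] by (auto simp: word_simps)
        then have "h \<otimes> inv g = inv g \<otimes> d [^] n"
          unfolding n using b g d by (intro conj_int_pow) auto
        then have "g \<otimes> h \<otimes> inv g = d [^] n"
          using b g d n by (simp add: word_simps)
        also have "\<dots> = b [^] ((l * i + 1) * n)" using b d by (simp add: int_pow_pow)
        finally show "g \<otimes> h \<otimes> inv g \<in> powers b" by blast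
      qed
      then have "card (powers b) \<le> card (powers a)" using max b a by (simp add: card_powers)
      moreover have "powers a \<subseteq> powers b" using \<open>a \<in> powers b\<close> b powers_mono by simp
      moreover have "finite (powers b)"
        using finite_G b finite_subset[of "powers b" "carrier G"] by auto
      ultimately have "powers a = powers b" using card_seteq by blast
      then show False using b powers_self by auto
    qed
    moreover have "\<one> \<in> powers b" using int_pow_0[of G b] by (metis rangeI)
    ultimately have "int p dvd i" "a \<noteq> \<one>"
      using powers_of_coprime_power[OF a(1) b(1) i] by auto
    then obtain j where "i = int p * j" by auto
    \<comment> \<open>\<open>b\<close> commutes with \<open>a\<close>, so the action exponent is 1
      and the geometric sum equals \<open>p\<close>, that is u = 1.\<close>
    then have "b \<in> powers a"
      using root_in_powers[of a b 1 j 1] a b i b_comm \<open>a \<noteq> \<one>\<close> prime_p by (auto simp: prime_nat_iff)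
    then show False using b by simp
  qed
  then show thesis using that a by blast
qed

text \<open>By \<open>root_in_powers\<close>, \<open>p\<close> cannot divide the geometric sum of
  the action exponent \<open>r\<close> exactly once. For odd \<open>p\<close> it does, since r^p = 1
  modulo \<open>p\<close> forces r = 1 modulo \<open>p\<close>. For p = 2 the sum is 1 + r, so
  \<open>r\<close> is not 1 modulo 4 and \<open>quaternion_exponents\<close> applies.\<close>

lemma outside_self_centralizing:
  assumes a: "a \<in> carrier G" "powers a \<lhd> G"
    and self_centr: "\<And>c. c \<in> carrier G \<Longrightarrow> a \<otimes> c = c \<otimes> a \<Longrightarrow> c \<in> powers a"
    and b: "b \<in> carrier G" "b \<notin> powers a" "b [^] p \<in> powers a"
  shows "p = 2" "a \<otimes> b = b \<otimes> inv a"
    "\<exists>k\<ge>1. ord a = 2 * 2 ^ k \<and> b [^] (2::nat) = a [^] ((2::nat) ^ k)"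
proof -
  interpret A: normal "powers a" G by (rule a)
  have a1: "a \<noteq> \<one>" using self_centr[of b] b by auto
  obtain m where m: "ord a = p ^ m" using ord_prime_power a by blast
  have "m \<noteq> 0" using m a1 a ord_eq_1 by fastforce
  obtain i :: int where i: "b [^] p = a [^] i" using b by blast
  have "int p dvd i"
  proof (rule ccontr)
    assume "\<not> int p dvd i"
    then obtain l :: int where "a = b [^] l"
      using powers_of_coprime_power[OF a(1) b(1) i] by blast
    then have "a \<otimes> b = b \<otimes> a" using conj_int_pow[of b b b l] b by simp
    then show False using self_centr b by blast
  qed
  then obtain j where j: "i = int p * j" by auto
  obtain r :: int where r: "a \<otimes> b = b \<otimes> a [^] r"
    using normal_powers_conj[OF a(2,1), of b] b by auto
  have no_sum: "int p dvd u" if "(\<Sum>k<p. r ^ k) = int p * u" for u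
    using root_in_powers[of a b r j u] that a a1 b r i j by auto
  \<comment> \<open>Being a power of \<open>a\<close>, b^p acts trivially on \<open>a\<close>, while
    it acts by the exponent r^p.\<close>
  have "a \<otimes> b [^] p = b [^] p \<otimes> a"
    using conj_int_pow[of a a a i] a i by simp
  then have "a [^] (r ^ p) = a [^] (1::int)"
    using conj_iterate[OF a(1) b(1) r, of p] a b by simp
  then have rp: "int (ord a) dvd r ^ p - 1"
    using a by (subst (asm) int_pow_eq) (auto simp: dvd_diff_commute)
  then have rp': "int p dvd r ^ p - 1"
    using m \<open>m \<noteq> 0\<close> by (metis dvd_power dvd_trans gr0I of_nat_power)
  show p2: "p = 2"
  proof (rule ccontr)
    assume "p \<noteq> 2"
    have p0: "p > 0" using prime_p by (rule prime_gt_0_nat)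
    have "\<not> int p dvd r"
    proof
      assume "int p dvd r"
      then have "int p dvd r ^ p" using p0 by (meson dvd_power dvd_trans)
      then have "int p dvd r ^ p - (r ^ p - 1)" using rp' by (rule dvd_diff)
      then show False using prime_p by simp
    qed
    have "[nat (r mod int p) ^ (p - 1) = 1] (mod p)"
    proof (rule fermat_theorem[OF prime_p])
      have "int p dvd int (nat (r mod int p)) \<longleftrightarrow> int p dvd r" using p0 by (simp add: dvd_mod_iff)
      then show "\<not> p dvd nat (r mod int p)"
        using \<open>\<not> int p dvd r\<close> int_dvd_int_iff by blast
    qed
    then have "[int (nat (r mod int p)) ^ (p - 1) = 1] (mod int p)"
      by (metis cong_int_iff of_nat_1 of_nat_power)
    then have "[r ^ (p - 1) = 1] (mod int p)"
      using p0 by (simp add: cong_def power_mod)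
    then have "[r ^ (p - 1) * r = 1 * r] (mod int p)" by (rule cong_mult) simp
    then have "int p dvd r ^ p - r"
      using power_minus_mult[OF p0, of r] by (simp add: cong_iff_dvd_diff)
    then have "int p dvd (r ^ p - 1) - (r ^ p - r)" by (rule dvd_diff[OF rp'])
    then have "int p dvd r - 1" by simp
    then obtain u where "(\<Sum>k<p. r ^ k) = int p * u" "\<not> int p dvd u"
      using geometric_sum_prime prime_p \<open>p \<noteq> 2\<close> by metis
    then show False using no_sum by blast
  qed
  have S2: "(\<Sum>k<p. r ^ k) = 1 + r" using p2 by (simp add: numeral_2_eq_2)
  have "\<not> 4 dvd r - 1"
  proof
    assume "4 dvd r - 1"
    then obtain q where "r = 4 * q + 1" by (auto simp: dvd_def algebra_simps)
    then show False using no_sum[of "2 * q + 1"] S2 p2 by auto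
  qed
  have N: "int (ord a) = 2 ^ m" using m p2 by simp
  have b2: "b [^] (2::nat) = a [^] (2 * j)" using i j p2 by simp
  have "a [^] (2 * j) \<otimes> b = b \<otimes> (a [^] r) [^] (2 * j)"
    using a b r by (intro conj_int_pow) auto
  moreover have "b [^] (2::nat) \<otimes> b = b \<otimes> b [^] (2::nat)"
    using group_commutes_pow[of b b 2] b by simp
  ultimately have "b \<otimes> a [^] (2 * j) = b \<otimes> a [^] (r * (2 * j))"
    using a b2 by (simp add: int_pow_pow)
  then have "a [^] (2 * j) = a [^] (r * (2 * j))" using a b by simp
  then have rj: "int (ord a) dvd 2 * j * (r - 1)"
    using a by (subst (asm) int_pow_eq) (auto simp: algebra_simps)
  \<comment> \<open>All involutions lie in \<open>powers a\<close>. Applied to \<open>b\<close> and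
    to \<open>b \<otimes> a\<close>, this yields the two conditions on \<open>j\<close>.\<close>
  have no_inv: "b' [^] (2::nat) \<noteq> \<one>" if "b' \<in> carrier G" "b' \<notin> powers a" for b'
    using order_p_in_powers[OF a(1) a1, of b'] that p2 by auto
  have j1: "\<not> int (ord a) dvd 2 * j"
    using no_inv[of b] b b2 int_pow_eq_id[OF a(1), of "2 * j"] by auto
  have "b \<otimes> a \<notin> powers a"
  proof
    assume "b \<otimes> a \<in> powers a"
    then obtain l :: int where "b \<otimes> a [^] (1::int) = a [^] l" using a by auto
    then have "b = a [^] (l - 1)" using a b powers_cancel by blast
    then show False using b by blast
  qed
  moreover have "(b \<otimes> a) [^] (2::nat) = a [^] (2 * j + (r + 1))"
  proof -
    have "(b \<otimes> a [^] (1::int)) [^] (2::nat) = b [^] (2::nat) \<otimes> a [^] (1 + r)"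
      using twisted_power[OF a(1) b(1) r, of 1 2] S2 p2 by simp
    also have "\<dots> = a [^] (2 * j + (1 + r))" unfolding b2 by (rule int_pow_mult[OF a(1), symmetric])
    finally show ?thesis using a by (simp add: add.commute)
  qed
  ultimately have j2: "\<not> int (ord a) dvd 2 * j + (r + 1)"
    using no_inv[of "b \<otimes> a"] a b int_pow_eq_id[OF a(1), of "2 * j + (r + 1)"] by auto
  have rp2: "int (ord a) dvd r ^ 2 - 1" using rp p2 by simp
  have "m \<ge> 1" using \<open>m \<noteq> 0\<close> by simp
  note ex = quaternion_exponents[OF N this rp2 \<open>\<not> 4 dvd r - 1\<close> rj j1 j2]
  have "a [^] r = a [^] (-1::int)"
    using ex(1) a by (subst int_pow_eq) (auto simp: dvd_diff_commute)
  then show "a \<otimes> b = b \<otimes> inv a" using r a by (simp add: int_pow_neg)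
  obtain k where k: "k \<ge> 1" "int (ord a) = 2 * 2 ^ k" "int (ord a) dvd 2 * j - 2 ^ k" using ex(2) by blast
  have "a [^] (2 * j) = a [^] ((2::int) ^ k)"
    using k(3) a by (subst int_pow_eq) (auto simp: dvd_diff_commute)
  also have "\<dots> = a [^] ((2::nat) ^ k)" by (simp flip: int_pow_int)
  finally have "b [^] (2::nat) = a [^] ((2::nat) ^ k)" using b2 by simp
  moreover have "int (ord a) = int (2 * 2 ^ k)" using k(2) by simp
  then have "ord a = 2 * 2 ^ k" by (simp only: of_nat_eq_iff)
  ultimately show "\<exists>k\<ge>1. ord a = 2 * 2 ^ k \<and> b [^] (2::nat) = a [^] ((2::nat) ^ k)"
    using k(1) by blast
qed

text \<open>Every element outside \<open>powers a\<close> whose square lies inside inverts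
  \<open>a\<close>. Once all elements outside are known to be of this kind,
  \<open>inv b \<otimes> g\<close> centralizes \<open>a\<close> for each such \<open>g\<close>,
  hence lies in \<open>powers a\<close>, which therefore has index 2.\<close>

theorem cyclic_or_quaternion:
  obtains (cyclic) a where "a \<in> carrier G" "carrier G = powers a"
  | (quaternion) a b l where "p = 2" "l \<ge> 1" "a \<in> carrier G" "b \<in> carrier G" "ord a = 2 * 2 ^ l"
    "b [^] (2::nat) = a [^] ((2::nat) ^ l)" "a \<otimes> b = b \<otimes> inv a" "b \<notin> powers a"
    "\<And>g. g \<in> carrier G \<Longrightarrow> g \<in> powers a \<or> inv b \<otimes> g \<in> powers a"
proof -
  obtain a where a: "a \<in> carrier G" "powers a \<lhd> G"
    and self_centr: "\<And>c. c \<in> carrier G \<Longrightarrow> a \<otimes> c = c \<otimes> a \<Longrightarrow> c \<in> powers a"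
    using self_centralizing_cyclic_normal by blast
  interpret A: normal "powers a" G by (rule a)
  note outside = outside_self_centralizing[OF a self_centr]
  show thesis
  proof (cases "carrier G \<subseteq> powers a")
    case True
    then show ?thesis using cyclic a by blast
  next
    case False
    then obtain b0 where b0: "b0 \<in> carrier G" "b0 \<notin> powers a" by auto
    obtain t where "b0 [^] (p ^ t) \<notin> powers a" "(b0 [^] (p ^ t)) [^] p \<in> powers a"
      using last_power_outside[OF A.subgroup_axioms b0] by metis
    then obtain b where b: "b \<in> carrier G" "b \<notin> powers a" "b [^] p \<in> powers a" using b0 by blast
    obtain l where l: "l \<ge> 1" "ord a = 2 * 2 ^ l" "b [^] (2::nat) = a [^] ((2::nat) ^ l)"
      using outside(3)[OF _ _ b] by blast
    have p2: "p = 2" using outside(1)[OF _ _ b] by blast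
    have b_inv: "a \<otimes> b = b \<otimes> inv a" using outside(2)[OF _ _ b] by blast
    \<comment> \<open>Otherwise some power \<open>h\<close> of \<open>g\<close> has a square that
      still lies outside and inverts \<open>a\<close>, so \<open>h\<close> acts by an
      \<open>r\<close> with r^2 = -1 modulo the order of \<open>a\<close>, a multiple of 4.\<close>
    have square: "g [^] p \<in> powers a" if g: "g \<in> carrier G" "g \<notin> powers a" for g
    proof -
      obtain t where t: "g [^] (p ^ t) \<notin> powers a" "(g [^] (p ^ t)) [^] p \<in> powers a"
        using last_power_outside[OF A.subgroup_axioms g] by metis
      show ?thesis
      proof (cases t)
        case 0
        then show ?thesis using t g by simp
      next
        case (Suc s)
        define h where "h = g [^] (p ^ s)"
        have h: "h \<in> carrier G" "h [^] (2::nat) = g [^] (p ^ t)"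
          using g Suc p2 by (auto simp: h_def nat_pow_pow mult.commute)
        obtain r :: int where r: "a \<otimes> h = h \<otimes> a [^] r"
          using normal_powers_conj[OF a(2,1), of h] h by auto
        have "a \<otimes> h [^] (2::nat) = h [^] (2::nat) \<otimes> inv a"
          using outside(2)[of "h [^] (2::nat)"] h t g by auto
        moreover have "a \<otimes> h [^] (2::nat) = h [^] (2::nat) \<otimes> a [^] (r ^ 2)"
          using conj_iterate[OF a(1) h(1) r] .
        ultimately have "h [^] (2::nat) \<otimes> a [^] (r ^ 2) = h [^] (2::nat) \<otimes> inv a" by simp
        then have "a [^] (r ^ 2) = inv a" using a h(1) by simp
        then have "a [^] (r ^ 2) = a [^] (-1::int)" using a by (simp add: int_pow_neg)
        then have "int (ord a) dvd - (r ^ 2 + 1)"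
          using a by (subst (asm) int_pow_eq) (auto simp: algebra_simps)
        then have "int (ord a) dvd r ^ 2 + 1" by (simp only: dvd_minus_iff)
        moreover have "4 dvd int (ord a)"
        proof -
          obtain l' where "l = Suc l'" using l(1) by (cases l) auto
          then show ?thesis using l(2) by simp
        qed
        ultimately have "4 dvd r ^ 2 + 1" by (rule dvd_trans[rotated])
        moreover have "\<not> 4 dvd r ^ 2 + 1"
        proof (cases "even r")
          case True
          then show ?thesis by (auto simp: power2_eq_square elim!: evenE) presburger
        next
          case False
          then obtain q where "r = 2 * q + 1" by (auto elim: oddE)
          then have "r ^ 2 + 1 = 4 * (q * q + q) + 2" by (simp add: power2_eq_square algebra_simps)
          then show ?thesis by presburger
        qed
        ultimately show ?thesis by simp
      qed
    qed
    have "inv b \<otimes> g \<in> powers a" if g: "g \<in> carrier G" "g \<notin> powers a" for g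
    proof (rule self_centr)
      show "inv b \<otimes> g \<in> carrier G" using b g by simp
      have "a \<otimes> g = g \<otimes> inv a" using outside(2)[OF _ _ g square[OF g]] by blast
      moreover have "a \<otimes> inv b = inv b \<otimes> inv a"
      proof -
        have "inv a \<otimes> b = b \<otimes> a"
          using conj_int_pow[of a b "inv a" "-1"] a b b_inv by (simp add: int_pow_neg)
        then have "inv b \<otimes> (inv a \<otimes> b) \<otimes> inv b = inv b \<otimes> (b \<otimes> a) \<otimes> inv b" by simp
        then show ?thesis using a b by (simp add: word_simps)
      qed
      ultimately show "a \<otimes> (inv b \<otimes> g) = inv b \<otimes> g \<otimes> a"
        using a b g
        by (metis inv_closed inv_solve_right m_assoc m_closed)
    qed
    then show thesis using quaternion[OF p2 l(1) a(1) b(1) l(2,3) b_inv b(2)] by blast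
  qed
qed

end

section \<open>The presentation of the generalized quaternion groups\<close>

fun word_value :: "('a, 'b) monoid_scheme \<Rightarrow> ('g \<Rightarrow> 'a) \<Rightarrow> 'g word \<Rightarrow> 'a" where
  "word_value G f [] = \<one>\<^bsub>G\<^esub>"
| "word_value G f ((g, e) # w) = (if e then f g else inv\<^bsub>G\<^esub> f g) \<otimes>\<^bsub>G\<^esub> word_value G f w"

context group
begin

lemma word_value_closed:
  assumes "\<And>g. f g \<in> carrier G"
  shows "word_value G f w \<in> carrier G"
proof (induction w)
  case (Cons x w)
  then show ?case using assms by (cases x) auto
qed simp

lemma word_value_append:
  assumes "\<And>g. f g \<in> carrier G"
  shows "word_value G f (u @ v) = word_value G f u \<otimes> word_value G f v"
proof (induction u)
  case Nil
  show ?case using word_value_closed[of f, OF assms] by simp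
next
  case (Cons x u)
  obtain g e where "x = (g, e)" by (cases x)
  then show ?case using Cons assms word_value_closed[of f, OF assms] by (simp add: m_assoc)
qed

lemma word_value_replicate:
  assumes "\<And>g. f g \<in> carrier G"
  shows "word_value G f (replicate n (g, True)) = f g [^] n"
proof (induction n)
  case (Suc n)
  then show ?case using nat_pow_Suc2[of "f g" n] assms by simp
qed simp

text \<open>Von Dyck's theorem: once the relations hold in the group, evaluation is constant on word
  classes.\<close>

lemma word_value_eq:
  assumes f: "\<And>g. f g \<in> carrier G"
    and R: "\<And>u v. (u, v) \<in> R \<Longrightarrow> word_value G f u = word_value G f v"
    and "word_eq R u v"
  shows "word_value G f u = word_value G f v"
  using assms(3)
proof (induction rule: word_eq.induct)
  case (cancel g e)
  show ?case using f[of g] by simp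
qed (auto simp: R word_value_append[of f, OF f])

text \<open>The set of all a^i and b a^i is stable under left multiplication by letters, because b
  a^i = a^(-i) b and b^2 = a^n. Membership of \<open>y\<close> in the second family is written as
  \<open>inv b \<otimes> y \<in> powers a\<close>.\<close>

lemma quaternion_normal_form:
  assumes a: "a \<in> carrier G" and b: "b \<in> carrier G"
    and b2: "b [^] (2::nat) = a [^] (n::nat)" and ab: "a \<otimes> b = b \<otimes> inv a"
    and x: "x \<in> {a, inv a, b, inv b}" and y: "y \<in> carrier G"
    and split: "y \<in> powers a \<or> inv b \<otimes> y \<in> powers a"
  shows "x \<otimes> y \<in> powers a \<or> inv b \<otimes> (x \<otimes> y) \<in> powers a"
proof -
  have pow_ab: "a [^] (i::int) \<otimes> b = b \<otimes> a [^] (- i)" for i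
    using conj_int_pow[of a b "inv a" i] a b ab by (simp add: int_pow_inv int_pow_neg)
  have ba: "inv b \<otimes> a [^] i = a [^] (- i) \<otimes> inv b" for i :: int
  proof -
    have "a [^] (- i) \<otimes> inv b = inv b \<otimes> (b \<otimes> a [^] (- i)) \<otimes> inv b"
      using a b by (simp add: word_simps)
    also have "b \<otimes> a [^] (- i) = a [^] i \<otimes> b" by (rule pow_ab[symmetric])
    also have "inv b \<otimes> (a [^] i \<otimes> b) \<otimes> inv b = inv b \<otimes> a [^] i"
      using a b by (simp add: word_simps)
    finally show ?thesis ..
  qed
  have bb: "b \<otimes> b = a [^] int n" using b2 b by (simp add: numeral_2_eq_2 int_pow_int)
  have step: "a [^] (i::int) \<otimes> y \<in> powers a \<or> inv b \<otimes> (a [^] i \<otimes> y) \<in> powers a" for i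
    using split
  proof
    assume "y \<in> powers a"
    then obtain l :: int where "y = a [^] l" by blast
    then have "a [^] i \<otimes> y = a [^] (i + l)" using a by (simp add: int_pow_mult)
    then show ?thesis by blast
  next
    assume "inv b \<otimes> y \<in> powers a"
    then obtain l :: int where "inv b \<otimes> y = a [^] l" by blast
    then have "a [^] (- i) \<otimes> (inv b \<otimes> y) = a [^] (- i + l)" using a by (simp only: int_pow_mult)
    moreover have "inv b \<otimes> (a [^] i \<otimes> y) = a [^] (- i) \<otimes> (inv b \<otimes> y)"
      using ba[of i] a b y by (simp flip: m_assoc)
    ultimately show ?thesis by (metis rangeI)
  qed
  have swap: "b \<otimes> (a [^] i \<otimes> y) \<in> powers a \<or> inv b \<otimes> (b \<otimes> (a [^] i \<otimes> y)) \<in> powers a" for i :: int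
    using step[of i]
  proof
    assume "a [^] i \<otimes> y \<in> powers a"
    then show ?thesis using a b y by (simp add: inv_cancel_left)
  next
    assume "inv b \<otimes> (a [^] i \<otimes> y) \<in> powers a"
    then obtain l :: int where l: "inv b \<otimes> (a [^] i \<otimes> y) = a [^] l" by blast
    have "b \<otimes> (a [^] i \<otimes> y) = (b \<otimes> b) \<otimes> (inv b \<otimes> (a [^] i \<otimes> y))"
      using a b y by (simp add: word_simps)
    also have "\<dots> = a [^] (int n + l)" unfolding bb l using a by (simp add: int_pow_mult)
    finally show ?thesis by blast
  qed
  have inv_b: "inv b = b \<otimes> a [^] (- int n)"
  proof -
    have "a [^] (- int n) = inv (b \<otimes> b)" using a bb by (simp add: int_pow_neg)
    then show ?thesis using b by (simp add: word_simps)
  qed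
  \<comment> \<open>Since b^2 = a^n gives b^-1 = b a^(-n), each letter has the form treated by
    \<open>step\<close> or by \<open>swap\<close>.\<close>
  consider "x = a [^] (1::int)" | "x = a [^] (-1::int)" | "x = b \<otimes> a [^] (0::int)" | "x = b \<otimes> a [^] (- int n)"
    using x a b inv_b by (auto simp: int_pow_neg)
  then show ?thesis
  proof cases
    case 3
    then show ?thesis using swap[of 0] b y by simp
  next
    case 4
    then show ?thesis using swap[of "- int n"] a b y by (simp add: m_assoc)
  qed (use step in blast)+
qed

end

lemma one_presented_group: "\<one>\<^bsub>presented_group R\<^esub> = word_class R []"
  by (simp add: presented_group_def)

lemma inv_word_class_letter:
  "inv\<^bsub>presented_group R\<^esub> word_class R [(g, True)] = word_class R [(g, False)]"
proof -
  interpret Q: group "presented_group R" by (rule group_presented_group)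
  have in_Q: "word_class R w \<in> carrier (presented_group R)" for w
    by (simp add: presented_group_def)
  have "word_class R [(g, False)] \<otimes>\<^bsub>presented_group R\<^esub> word_class R [(g, True)] = \<one>\<^bsub>presented_group R\<^esub>"
    using word_eq.cancel[of R g False]
    by (simp add: mult_word_class one_presented_group word_class_eq_iff)
  then show ?thesis using in_Q by (intro Q.inv_equality)
qed

lemma word_value_word_class:
  "word_value (presented_group R) (\<lambda>g. word_class R [(g, True)]) w = word_class R w"
proof (induction w)
  case Nil
  show ?case by (simp add: one_presented_group)
next
  case (Cons x w)
  then show ?case
    by (cases x) (simp add: inv_word_class_letter mult_word_class)
qed

section \<open>The presented quaternion group\<close>

abbreviation quat_a :: "nat \<Rightarrow> quat_gen word set" where
  "quat_a n \<equiv> word_class (quaternion_relations n) [(Gen_a, True)]"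

abbreviation quat_b :: "nat \<Rightarrow> quat_gen word set" where
  "quat_b n \<equiv> word_class (quaternion_relations n) [(Gen_b, True)]"

text \<open>Evaluating a word at the classes of the generators returns its own class, so each
  defining relation becomes an equation in \<open>Q\<close>. The last claim follows by reading a
  word letter by letter with \<open>quaternion_normal_form\<close>.\<close>

lemma quaternion_group_structure:
  fixes n :: nat
  defines "Q \<equiv> quaternion_group n"
  shows "group Q" "quat_a n \<in> carrier Q" "quat_b n \<in> carrier Q"
    "quat_a n [^]\<^bsub>Q\<^esub> (2 * n) = \<one>\<^bsub>Q\<^esub>" "quat_b n [^]\<^bsub>Q\<^esub> (2::nat) = quat_a n [^]\<^bsub>Q\<^esub> n"
    "quat_a n \<otimes>\<^bsub>Q\<^esub> quat_b n = quat_b n \<otimes>\<^bsub>Q\<^esub> inv\<^bsub>Q\<^esub> quat_a n"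
    "\<And>x. x \<in> carrier Q \<Longrightarrow> x \<in> group.powers Q (quat_a n) \<or>
        inv\<^bsub>Q\<^esub> quat_b n \<otimes>\<^bsub>Q\<^esub> x \<in> group.powers Q (quat_a n)"
proof -
  let ?R = "quaternion_relations n"
  show grp: "group Q" unfolding Q_def quaternion_group_def by (rule group_presented_group)
  interpret Q: group Q by (rule grp)
  have Q: "Q = presented_group ?R" by (simp add: Q_def quaternion_group_def)
  let ?f = "\<lambda>g. word_class ?R [(g, True)]"
  have f: "?f g \<in> carrier Q" for g by (simp add: Q presented_group_def)
  show a: "quat_a n \<in> carrier Q" and b: "quat_b n \<in> carrier Q" by (rule f)+
  have val: "word_value Q ?f w = word_class ?R w" for w
    unfolding Q by (rule word_value_word_class)
  have rel: "word_value Q ?f u = word_value Q ?f v" if "(u, v) \<in> ?R" for u v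
    using that by (simp add: val word_class_eq_iff word_eq.rel)
  note repl = Q.word_value_replicate[of ?f, OF f]
  show "quat_a n [^]\<^bsub>Q\<^esub> (2 * n) = \<one>\<^bsub>Q\<^esub>"
    using rel[of "replicate (2 * n) (Gen_a, True)" "[]"] repl[of "2 * n" Gen_a]
    by (simp add: quaternion_relations_def)
  show b2: "quat_b n [^]\<^bsub>Q\<^esub> (2::nat) = quat_a n [^]\<^bsub>Q\<^esub> n"
    using rel[of "replicate n (Gen_a, True)" "replicate 2 (Gen_b, True)"] repl[of n Gen_a] repl[of 2 Gen_b]
    by (simp add: quaternion_relations_def)
  have "inv\<^bsub>Q\<^esub> quat_b n \<otimes>\<^bsub>Q\<^esub> (quat_a n \<otimes>\<^bsub>Q\<^esub> quat_b n) = inv\<^bsub>Q\<^esub> quat_a n"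
    using rel[of "[(Gen_b, False), (Gen_a, True), (Gen_b, True)]" "[(Gen_a, False)]"] a b
    by (simp add: quaternion_relations_def)
  then show ab: "quat_a n \<otimes>\<^bsub>Q\<^esub> quat_b n = quat_b n \<otimes>\<^bsub>Q\<^esub> inv\<^bsub>Q\<^esub> quat_a n"
    using a b Q.inv_cancel_left(2)[of "quat_b n" "quat_a n \<otimes>\<^bsub>Q\<^esub> quat_b n"] by simp
  have "word_class ?R w \<in> Q.powers (quat_a n) \<or>
      inv\<^bsub>Q\<^esub> quat_b n \<otimes>\<^bsub>Q\<^esub> word_class ?R w \<in> Q.powers (quat_a n)" for w
  proof (induction w)
    case Nil
    have "word_class ?R [] = quat_a n [^]\<^bsub>Q\<^esub> (0::int)" by (simp add: Q one_presented_group)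
    then show ?case by blast
  next
    case (Cons x w)
    obtain g e where x: "x = (g, e)" by (cases x)
    define y where "y = (if e then ?f g else inv\<^bsub>Q\<^esub> ?f g)"
    have "word_class ?R (x # w) = y \<otimes>\<^bsub>Q\<^esub> word_class ?R w"
      using val[of "x # w"] val[of w] x unfolding y_def by simp
    moreover have "y \<in> {quat_a n, inv\<^bsub>Q\<^esub> quat_a n, quat_b n, inv\<^bsub>Q\<^esub> quat_b n}"
      unfolding y_def by (cases g) auto
    moreover have "word_class ?R w \<in> carrier Q" by (simp add: Q presented_group_def)
    ultimately show ?case
      using Q.quaternion_normal_form[OF a b b2 ab _ _ Cons] by simp
  qed
  then show "x \<in> Q.powers (quat_a n) \<or> inv\<^bsub>Q\<^esub> quat_b n \<otimes>\<^bsub>Q\<^esub> x \<in> Q.powers (quat_a n)"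
    if "x \<in> carrier Q" for x
    using that by (auto simp: Q presented_group_def)
qed

text \<open>Evaluation induces a homomorphism from the presented group. It is onto by
  \<open>split\<close>. A power of \<open>quat_a n\<close> in the kernel has exponent divisible by
  2n, the order of \<open>a\<close>, and is trivial; a kernel element of the other coset would put
  \<open>b\<close> into \<open>powers a\<close>.\<close>

lemma (in group) iso_quaternion_group:
  assumes a: "a \<in> carrier G" "ord a = 2 * n" and b: "b \<in> carrier G" "b \<notin> powers a"
    and b2: "b [^] (2::nat) = a [^] n" and ab: "a \<otimes> b = b \<otimes> inv a"
    and split: "\<And>g. g \<in> carrier G \<Longrightarrow> g \<in> powers a \<or> inv b \<otimes> g \<in> powers a"
  shows "G \<cong> quaternion_group n"
proof -
  define Q where "Q = quaternion_group n"
  let ?R = "quaternion_relations n"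
  note struct = quaternion_group_structure[where n=n, folded Q_def]
  have Q: "Q = presented_group ?R" by (simp add: Q_def quaternion_group_def)
  interpret Q: group Q by (rule struct)
  define f where "f = (\<lambda>g. case g of Gen_a \<Rightarrow> a | Gen_b \<Rightarrow> b)"
  have f: "f g \<in> carrier G" for g using a b by (cases g) (auto simp: f_def)
  have repl: "word_value G f (replicate m (g, True)) = f g [^] m" for m g
    by (rule word_value_replicate[OF f])
  have conj: "inv b \<otimes> (a \<otimes> b) = inv a"
    unfolding ab using a b by (simp add: inv_cancel_left)
  have R: "word_value G f u = word_value G f v" if uv: "(u, v) \<in> ?R" for u v
  proof -
    consider "u = replicate n (Gen_a, True)" "v = replicate 2 (Gen_b, True)"
      | "u = replicate (2 * n) (Gen_a, True)" "v = []"
      | "u = [(Gen_b, False), (Gen_a, True), (Gen_b, True)]" "v = [(Gen_a, False)]"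
      using uv unfolding quaternion_relations_def by blast
    then show ?thesis
    proof cases
      case 1
      then show ?thesis using repl[of n Gen_a] repl[of 2 Gen_b] b2 by (simp add: f_def)
    next
      case 2
      then show ?thesis using repl[of "2 * n" Gen_a] a pow_ord_eq_1[of a] by (simp add: f_def)
    next
      case 3
      then show ?thesis using conj a b by (simp add: f_def)
    qed
  qed
  \<comment> \<open>All words of a class have the same value, so the image of the class is a
    singleton.\<close>
  define \<psi> where "\<psi> X = the_elem (word_value G f ` X)" for X
  have \<psi>: "\<psi> (word_class ?R w) = word_value G f w" for w
  proof -
    have "word_value G f v = word_value G f w" if v: "v \<in> word_class ?R w" for v
    proof -
      have "word_eq ?R w v" using v by (simp add: word_class_def)
      then show ?thesis using word_value_eq[OF f R] by simp
    qed
    moreover have "w \<in> word_class ?R w" by (simp add: word_class_def word_eq.refl)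
    ultimately have "word_value G f ` word_class ?R w = {word_value G f w}" by blast
    then show ?thesis by (simp add: \<psi>_def)
  qed
  have carr: "carrier Q = range (word_class ?R)" by (simp add: Q presented_group_def)
  have hom: "\<psi> \<in> hom Q G"
  proof (rule homI)
    show "\<psi> X \<in> carrier G" if "X \<in> carrier Q" for X
      using that word_value_closed[of f, OF f] by (auto simp: carr \<psi>)
    show "\<psi> (X \<otimes>\<^bsub>Q\<^esub> Y) = \<psi> X \<otimes> \<psi> Y" if XY: "X \<in> carrier Q" "Y \<in> carrier Q" for X Y
    proof -
      obtain u v where "X = word_class ?R u" "Y = word_class ?R v" using XY carr by auto
      then show ?thesis using word_value_append[of f, OF f] by (simp add: \<psi> Q mult_word_class)
    qed
  qed
  interpret \<psi>: group_hom Q G \<psi> by unfold_locales (rule hom)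
  have \<psi>a: "\<psi> (quat_a n) = a" and \<psi>b: "\<psi> (quat_b n) = b"
    using a b by (simp_all add: \<psi> f_def)
  have \<psi>a_pow: "\<psi> (quat_a n [^]\<^bsub>Q\<^esub> (i::int)) = a [^] i" for i
    using hom_int_pow[OF hom struct(2) struct(1) is_group] \<psi>a by simp
  have "x = \<one>\<^bsub>Q\<^esub>" if x: "x \<in> carrier Q" "\<psi> x = \<one>" for x
    using struct(7)[OF x(1)]
  proof
    assume "x \<in> Q.powers (quat_a n)"
    then obtain i :: int where i: "x = quat_a n [^]\<^bsub>Q\<^esub> i" by blast
    then have "int (2 * n) dvd i" using x \<psi>a_pow[of i] a int_pow_eq_id[of a i] by simp
    moreover have "Q.ord (quat_a n) dvd 2 * n" using struct(2,4) Q.pow_eq_id by blast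
    ultimately have "int (Q.ord (quat_a n)) dvd i" by (metis dvd_trans int_dvd_int_iff)
    then show ?thesis using i struct(2) Q.int_pow_eq_id by blast
  next
    assume "inv\<^bsub>Q\<^esub> quat_b n \<otimes>\<^bsub>Q\<^esub> x \<in> Q.powers (quat_a n)"
    then obtain i :: int where i: "inv\<^bsub>Q\<^esub> quat_b n \<otimes>\<^bsub>Q\<^esub> x = quat_a n [^]\<^bsub>Q\<^esub> i" by blast
    have "\<psi> (inv\<^bsub>Q\<^esub> quat_b n \<otimes>\<^bsub>Q\<^esub> x) = inv b \<otimes> \<one>"
      using x \<psi>b struct(3) by simp
    then have "inv b = a [^] i" unfolding i \<psi>a_pow using b by simp
    then have "b = inv (a [^] i)" using b by (metis inv_inv)
    then have "b = a [^] (- i)" using a by (simp add: int_pow_neg)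
    then show ?thesis using b(2) by blast
  qed
  then have inj: "inj_on \<psi> (carrier Q)" using \<psi>.inj_on_one_iff by blast
  have "carrier G \<subseteq> \<psi> ` carrier Q"
  proof
    fix g assume g: "g \<in> carrier G"
    from split[OF g] show "g \<in> \<psi> ` carrier Q"
    proof
      assume "g \<in> powers a"
      then obtain i :: int where "g = a [^] i" by blast
      then have "g = \<psi> (quat_a n [^]\<^bsub>Q\<^esub> i)" using \<psi>a_pow by simp
      then show ?thesis using struct(2) by blast
    next
      assume "inv b \<otimes> g \<in> powers a"
      then obtain i :: int where i: "inv b \<otimes> g = a [^] i" by blast
      have "g = b \<otimes> (inv b \<otimes> g)" using b g by (simp add: inv_cancel_left)
      also have "\<dots> = \<psi> (quat_b n \<otimes>\<^bsub>Q\<^esub> quat_a n [^]\<^bsub>Q\<^esub> i)"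
        unfolding i using \<psi>a_pow \<psi>b struct(2,3) by simp
      finally show ?thesis using struct(2,3) by blast
    qed
  qed
  then have "\<psi> \<in> iso Q G"
    using hom inj \<psi>.hom_closed by (auto simp: iso_def bij_betw_def)
  then show ?thesis
    unfolding Q_def[symmetric] using Q.iso_sym is_isoI by blast
qed

text \<open>Separates quaternion groups from cyclic groups of odd order without counting elements:
  commutativity turns inversion of \<open>a\<close> into a^2 = 1, odd order then gives a = 1, hence
  b^2 = 1 and b = 1.\<close>

lemma commutative_odd_quaternion_group:
  assumes comm: "\<And>x y. x \<in> carrier (quaternion_group n) \<Longrightarrow> y \<in> carrier (quaternion_group n) \<Longrightarrow>
      x \<otimes>\<^bsub>quaternion_group n\<^esub> y = y \<otimes>\<^bsub>quaternion_group n\<^esub> x"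
    and odd: "odd (order (quaternion_group n))"
  shows "order (quaternion_group n) = 1"
proof -
  define Q where "Q = quaternion_group n"
  note struct = quaternion_group_structure[where n=n, folded Q_def]
  note comm = comm[folded Q_def]
  interpret Q: group Q by (rule struct)
  have no_involution: "x = \<one>\<^bsub>Q\<^esub>" if "x \<in> carrier Q" "x \<otimes>\<^bsub>Q\<^esub> x = \<one>\<^bsub>Q\<^esub>" for x
  proof -
    have "Q.ord x dvd 2" using that Q.pow_eq_id[of x 2] by (simp add: numeral_2_eq_2)
    moreover have "odd (Q.ord x)"
      using Q.ord_dvd_group_order[OF that(1)] odd dvd_trans unfolding Q_def by blast
    ultimately have "Q.ord x = 1" by (metis dvd_refl prime_nat_iff two_is_prime_nat)
    then show ?thesis using that Q.ord_eq_1 by blast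
  qed
  have "quat_b n \<otimes>\<^bsub>Q\<^esub> quat_a n = quat_b n \<otimes>\<^bsub>Q\<^esub> inv\<^bsub>Q\<^esub> quat_a n"
    using comm struct(2,3,6) by metis
  then have "quat_a n = inv\<^bsub>Q\<^esub> quat_a n" using struct(2,3) by simp
  then have "quat_a n \<otimes>\<^bsub>Q\<^esub> quat_a n = \<one>\<^bsub>Q\<^esub>" using Q.r_inv[OF struct(2)] by simp
  then have a: "quat_a n = \<one>\<^bsub>Q\<^esub>" using no_involution struct(2) by blast
  then have "quat_b n \<otimes>\<^bsub>Q\<^esub> quat_b n = \<one>\<^bsub>Q\<^esub>" using struct(3,5) by (simp add: numeral_2_eq_2)
  then have b: "quat_b n = \<one>\<^bsub>Q\<^esub>" using no_involution struct(3) by blast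
  have "carrier Q = {\<one>\<^bsub>Q\<^esub>}" using struct(7) by (auto simp: a b)
  then show ?thesis unfolding Q_def[symmetric] by (simp add: order_def)
qed

section \<open>Moufang loops of prime power order\<close>

lemma group_imp_loop:
  assumes "group G"
  shows "loop G"
proof -
  interpret group G by fact
  show ?thesis
  proof
    show "bij_betw (\<lambda>y. x \<otimes>\<^bsub>G\<^esub> y) (carrier G) (carrier G)" if x: "x \<in> carrier G" for x
    proof (rule bij_betwI[where g = "\<lambda>y. inv\<^bsub>G\<^esub> x \<otimes>\<^bsub>G\<^esub> y"])
    qed (use x in \<open>auto simp: inv_cancel_left\<close>)
    show "bij_betw (\<lambda>y. y \<otimes>\<^bsub>G\<^esub> x) (carrier G) (carrier G)" if x: "x \<in> carrier G" for x
    proof (rule bij_betwI[where g = "\<lambda>y. y \<otimes>\<^bsub>G\<^esub> inv\<^bsub>G\<^esub> x"])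
    qed (use x in \<open>auto simp: m_assoc\<close>)
  qed auto
qed

lemma associative_loop_imp_group:
  assumes "associative_loop G"
  shows "group G"
proof -
  interpret loop G using assms by (simp add: associative_loop_def)
  show ?thesis
  proof (rule groupI)
    show "\<exists>y\<in>carrier G. y \<otimes>\<^bsub>G\<^esub> x = \<one>\<^bsub>G\<^esub>" if "x \<in> carrier G" for x
      using col_bij[OF that] one_closed unfolding bij_betw_def by (metis imageE)
  qed (use assms in \<open>auto simp: associative_loop_def one_closed l_one m_closed\<close>)
qed

lemma group_imp_associative_loop: "group G \<Longrightarrow> associative_loop G"
  by (simp add: associative_loop_def group_imp_loop group.is_monoid monoid.m_assoc)

lemma nat_pow_carrier_update: "x [^]\<^bsub>G\<lparr>carrier := H\<rparr>\<^esub> (n::nat) = x [^]\<^bsub>G\<^esub> n"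
  by (simp add: nat_pow_def)

lemma (in group) powers_finite:
  assumes "finite (carrier G)" "a \<in> carrier G"
  shows "powers a = range (\<lambda>n::nat. a [^] n)"
  using assms generate_pow_nat[of a] ord_ge_1[of a] by (auto simp: powers_eq_generate)

section \<open>Powers and two-generated groups in finite Moufang loops\<close>

context moufang_loop
begin

abbreviation nat_powers :: "'a \<Rightarrow> 'a set" where
  "nat_powers x \<equiv> range (\<lambda>n::nat. x [^] n)"

lemma pow_closed: "x \<in> carrier M \<Longrightarrow> x [^] (n::nat) \<in> carrier M"
  by (induction n) (auto simp: loop_closed)

text \<open>Left multiplication by \<open>x\<^sup>n\<^sup>+\<^sup>2 = (x x\<^sup>n) x\<close> is determined by Moufang's identity.\<close>

lemma pow_eq_funpow:
  assumes x: "x \<in> carrier M"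
  shows "y \<in> carrier M \<Longrightarrow> x [^] (n::nat) \<otimes> y = ((\<lambda>z. x \<otimes> z) ^^ n) y"
proof (induction n arbitrary: y rule: less_induct)
  case (less n)
  consider "n = 0" | "n = 1" | m where "n = Suc (Suc m)"
    by (metis One_nat_def not0_implies_Suc)
  then show ?case
  proof cases
    case 3
    \<comment> \<open>\<open>[^]\<close> multiplies on the right. Two instances of the induction
      hypothesis move one factor to the left, which gives the shape that Moufang's identity
      requires.\<close>
    have "x [^] Suc m \<otimes> x = x \<otimes> (x [^] m \<otimes> x)"
      using less.IH[of "Suc m" x] less.IH[of m x] 3 x by simp
    then have "x [^] n = (x \<otimes> x [^] m) \<otimes> x"
      using 3 x by (simp add: flexible pow_closed)
    then have "x [^] n \<otimes> y = x \<otimes> (x [^] m \<otimes> (x \<otimes> y))"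
      using moufang[of "x [^] m" y x] x less.prems by (simp add: pow_closed)
    also have "x [^] m \<otimes> (x \<otimes> y) = ((\<lambda>z. x \<otimes> z) ^^ m) (x \<otimes> y)"
      using less.IH[of m "x \<otimes> y"] 3 x less.prems by (simp add: m_closed)
    finally show ?thesis using 3 by (simp add: funpow_swap1)
  qed (use less.prems x in \<open>simp_all add: l_one\<close>)
qed

lemma pow_mult_left:
  assumes "x \<in> carrier M" "y \<in> carrier M"
  shows "x [^] (m::nat) \<otimes> (x [^] (n::nat) \<otimes> y) = x [^] (m + n) \<otimes> y"
proof -
  have "x [^] m \<otimes> (x [^] n \<otimes> y) = ((\<lambda>z. x \<otimes> z) ^^ m) (x [^] n \<otimes> y)"
    using assms by (intro pow_eq_funpow m_closed pow_closed)
  also have "\<dots> = ((\<lambda>z. x \<otimes> z) ^^ (m + n)) y"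
    using pow_eq_funpow[of x y n] assms by (simp add: funpow_add)
  also have "\<dots> = x [^] (m + n) \<otimes> y" using assms by (simp only: pow_eq_funpow)
  finally show ?thesis .
qed

lemma pow_add: "x \<in> carrier M \<Longrightarrow> x [^] (m::nat) \<otimes> x [^] (n::nat) = x [^] (m + n)"
  using pow_mult_left[of x \<one> m n] by (simp add: one_closed r_one pow_closed)

lemma pow_pow: "x \<in> carrier M \<Longrightarrow> (x [^] (m::nat)) [^] (n::nat) = x [^] (m * n)"
  by (induction n) (auto simp: pow_add add.commute)

lemma finite_order:
  assumes "finite (carrier M)" "x \<in> carrier M"
  obtains n :: nat where "n > 0" "x [^] n = \<one>"
proof -
  have "\<not> inj (\<lambda>n::nat. x [^] n)"
    using assms pow_closed finite_subset[of "nat_powers x" "carrier M"] range_inj_infinite by blast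
  then obtain i j :: nat where "x [^] i = x [^] j" "i \<noteq> j" by (auto simp: inj_def)
  then obtain i j :: nat where ij: "x [^] i = x [^] j" "i < j" by (metis nat_neq_iff)
  have "x [^] i \<otimes> x [^] (j - i) = x [^] i \<otimes> \<one>"
    using ij assms pow_add[of x i "j - i"] by (simp add: r_one pow_closed)
  then have "x [^] (j - i) = \<one>"
    by (rule l_cancel) (use assms in \<open>simp_all add: pow_closed one_closed\<close>)
  then show thesis using that[of "j - i"] ij by simp
qed

lemma inv_in_nat_powers:
  assumes fin: "finite (carrier M)" and x: "x \<in> carrier M"
  shows "inv (x [^] (i::nat)) \<in> nat_powers x"
proof -
  obtain n :: nat where n: "n > 0" "x [^] n = \<one>" using finite_order[OF assms] .
  have one_pow: "\<one> [^] (k::nat) = \<one>" for k by (induction k) (simp_all add: l_one one_closed)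
  have "i + i * (n - 1) = n * i" using n by (cases n) auto
  then have "x [^] i \<otimes> x [^] (i * (n - 1)) = \<one>"
    using x pow_pow[OF x, of n i] n one_pow by (simp add: pow_add)
  then have "inv (x [^] i) = x [^] (i * (n - 1))"
    using x by (intro inv_unique) (simp_all add: pow_closed)
  then show ?thesis by blast
qed

text \<open>Diassociativity: the powers of \<open>x\<close> and the powers of \<open>y\<close> serve
  as the two subsets for alternating words. Finiteness makes inverses natural powers.\<close>

lemma two_generated_group:
  assumes fin: "finite (carrier M)" and x: "x \<in> carrier M" and y: "y \<in> carrier M"
  obtains W where "W \<subseteq> carrier M" "x \<in> W" "y \<in> W" "group (M\<lparr>carrier := W\<rparr>)"
proof -
  define g where "g c = (if c then x else y)" for c
  have g: "g c \<in> carrier M" for c using x y by (simp add: g_def)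
  interpret alternating_words M "\<lambda>c. nat_powers (g c)"
  proof
    show "\<one> \<in> nat_powers (g c)" for c by (metis nat_pow_0 rangeI)
    show "s \<otimes> t \<in> nat_powers (g c)" if "s \<in> nat_powers (g c)" "t \<in> nat_powers (g c)" for s t c
      using that g by (auto simp: pow_add)
    show "s \<otimes> (t \<otimes> z) = s \<otimes> t \<otimes> z"
      if "s \<in> nat_powers (g c)" "t \<in> nat_powers (g c)" "z \<in> carrier M" for s t z c
      using that g by (auto simp: pow_add pow_mult_left)
    show "inv s \<in> nat_powers (g c)" if "s \<in> nat_powers (g c)" for s c
      using that inv_in_nat_powers[OF fin g[of c]] by auto
  qed (use g pow_closed in auto)
  have "g c \<in> nat_powers (g c)" for c
    using g[of c] l_one by (intro image_eqI[of _ _ 1]) auto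
  then have "g c \<in> span" for c by (rule S_in_span)
  from this[of True] this[of False] show thesis
    using that[of span] span_closed group_span by (auto simp: g_def)
qed

lemma group_nat_powers:
  assumes fin: "finite (carrier M)" and x: "x \<in> carrier M"
  shows "group (M\<lparr>carrier := nat_powers x\<rparr>)"
proof (rule groupI; clarsimp)
  show "\<one> \<in> nat_powers x" by (metis nat_pow_0 rangeI)
  show "x [^] m \<otimes> x [^] n \<in> nat_powers x" for m n :: nat
    using x by (simp add: pow_add)
  show "x [^] l \<otimes> x [^] m \<otimes> x [^] n = x [^] l \<otimes> (x [^] m \<otimes> x [^] n)" for l m n :: nat
    using x by (simp add: pow_add add.assoc)
  show "\<one> \<otimes> x [^] n = x [^] n" for n :: nat
    using x by (simp add: l_one pow_closed)
  show "\<exists>m::nat. x [^] m \<otimes> x [^] n = \<one>" for n :: nat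
    using inv_in_nat_powers[OF fin x, of n] l_inv[of "x [^] n"] x pow_closed by (metis imageE)
qed

text \<open>Lagrange's argument for a cyclic subloop: its right cosets partition the loop because
  left multiplications by powers of \<open>x\<close> compose like the exponents.\<close>

lemma card_nat_powers_dvd:
  assumes fin: "finite (carrier M)" and x: "x \<in> carrier M"
  shows "card (nat_powers x) dvd order M"
  unfolding order_def
proof (rule equiv_imp_dvd_card)
  define R where "R = {(y, z). y \<in> carrier M \<and> (\<exists>n::nat. z = x [^] n \<otimes> y)}"
  have in_M: "x [^] (n::nat) \<in> carrier M" for n using x by (rule pow_closed)
  show "finite (carrier M)" by fact
  show "equiv (carrier M) R"
  proof (rule equivI)
    show "R \<subseteq> carrier M \<times> carrier M" using in_M m_closed by (auto simp: R_def)
    show "refl_on (carrier M) R"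
      by (auto simp: refl_on_def R_def intro!: exI[of _ 0] simp: l_one)
    show "Relation.sym R"
    proof (rule symI)
      fix y z assume "(y, z) \<in> R"
      then obtain n :: nat where n: "y \<in> carrier M" "z = x [^] n \<otimes> y" by (auto simp: R_def)
      obtain m :: nat where "inv (x [^] n) = x [^] m" using inv_in_nat_powers[OF fin x, of n] by auto
      then have "y = x [^] m \<otimes> z" using n in_M l_inv_cancel[of "x [^] n" y] by simp
      then show "(z, y) \<in> R" using n in_M m_closed by (auto simp: R_def)
    qed
    show "Relation.trans R"
      by (rule transI) (use x in \<open>auto simp: R_def pow_mult_left\<close>)
  qed
  show "card (nat_powers x) dvd card X" if X: "X \<in> carrier M // R" for X
  proof -
    obtain y where y: "y \<in> carrier M" "X = (\<lambda>s. s \<otimes> y) ` nat_powers x"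
      using X by (auto simp: quotient_def R_def)
    have "inj_on (\<lambda>s. s \<otimes> y) (nat_powers x)"
    proof (rule inj_onI)
      fix s t assume "s \<in> nat_powers x" "t \<in> nat_powers x" "s \<otimes> y = t \<otimes> y"
      then show "s = t" using r_cancel[of s y t] y in_M by auto
    qed
    then show ?thesis using y card_image[of "\<lambda>s. s \<otimes> y" "nat_powers x"] by simp
  qed
qed

lemma pow_order:
  assumes fin: "finite (carrier M)" and x: "x \<in> carrier M"
  shows "x [^] order M = \<one>"
proof -
  interpret A: group "M\<lparr>carrier := nat_powers x\<rparr>" by (rule group_nat_powers[OF assms])
  obtain q where q: "order M = card (nat_powers x) * q"
    using card_nat_powers_dvd[OF assms] by (auto simp: dvd_def)
  have xA: "x \<in> nat_powers x" using x l_one by (intro image_eqI[of _ _ 1]) auto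
  then have "x [^]\<^bsub>M\<lparr>carrier := nat_powers x\<rparr>\<^esub> card (nat_powers x) = \<one>"
    using A.pow_order_eq_1[of x] by (simp add: order_def)
  moreover have "\<one> [^] (n::nat) = \<one>" for n by (induction n) (simp_all add: l_one one_closed)
  ultimately show ?thesis
    using pow_pow[OF x, of "card (nat_powers x)" q] q by (simp add: nat_pow_carrier_update)
qed

end

lemma prime_power_if_unique_prime_divisor:
  fixes n p :: nat
  assumes "n > 0" "prime p" "\<And>q. prime q \<Longrightarrow> q dvd n \<Longrightarrow> q = p"
  obtains j where "n = p ^ j"
proof -
  obtain m where m: "n = p ^ multiplicity p n * m" "\<not> p dvd m"
    using multiplicity_decompose'[of n p] assms(1,2) by (metis mult.commute neq0_conv not_prime_unit)
  have "m = 1"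
  proof (rule ccontr)
    assume "m \<noteq> 1"
    then obtain q where "prime q" "q dvd m" using prime_factor_nat by blast
    then show False using assms(3)[of q] m by (metis dvd_mult)
  qed
  then show thesis using that[of "multiplicity p n"] m by simp
qed

section \<open>Moufang p-loops with a unique subloop of order p\<close>

locale unique_order_p_moufang = moufang_loop +
  fixes p k :: nat
  assumes prime_p: "prime p"
    and order_M: "order M = p ^ k"
    and unique_subloop: "\<exists>!H. subloop H M \<and> card H = p"
begin

lemma finite_M: "finite (carrier M)"
  using order_M prime_gt_0_nat[OF prime_p] unfolding order_def by (intro card_ge_0_finite) simp

text \<open>Divisibility of the loop order is established above only for cyclic subloops, so the
  order of \<open>W\<close> is treated prime by prime: a prime divisor \<open>q\<close> yields x
  \<noteq> 1 with x^q = 1, and also x^(p^k) = 1, whence q = p. Subgroups of \<open>W\<close> are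
  subloops, so uniqueness carries over.\<close>

lemma unique_order_p_subgroup:
  assumes W: "W \<subseteq> carrier M" and grp: "group (M\<lparr>carrier := W\<rparr>)"
  obtains j where "unique_order_p_group (M\<lparr>carrier := W\<rparr>) p j"
proof -
  interpret W: group "M\<lparr>carrier := W\<rparr>" by fact
  have fin: "finite W" using finite_M W finite_subset by blast
  have "W \<noteq> {}" using W.one_closed by auto
  then have pos: "order (M\<lparr>carrier := W\<rparr>) > 0" using fin by (simp add: order_def card_gt_0_iff)
  have "q = p" if q: "prime q" "q dvd order (M\<lparr>carrier := W\<rparr>)" for q
  proof (rule ccontr)
    assume "q \<noteq> p"
    obtain m where "order (M\<lparr>carrier := W\<rparr>) = q ^ 1 * m" using q(2) by (auto simp: dvd_def)
    \<comment> \<open>Cauchy's theorem, as Sylow's with exponent 1.\<close>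
    then obtain H where H: "subgroup H (M\<lparr>carrier := W\<rparr>)" "card H = q"
      using sylow_thm[of q "M\<lparr>carrier := W\<rparr>" 1 m] q(1) grp fin by auto
    have "H \<noteq> {\<one>}" using H(2) q(1) by auto
    then obtain x where x: "x \<in> H" "x \<noteq> \<one>" using subgroup.one_closed[OF H(1)] by auto
    have xW: "x \<in> W" using x subgroup.subset[OF H(1)] by auto
    interpret H: group "M\<lparr>carrier := H\<rparr>" using W.subgroup_imp_group[OF H(1)] by simp
    have "x [^]\<^bsub>M\<lparr>carrier := W\<rparr>\<^esub> q = \<one>"
      using H.pow_order_eq_1[of x] x H(2) by (simp add: order_def nat_pow_carrier_update)
    then have "W.ord x dvd q" using W.pow_eq_id[of x q] xW by simp
    moreover have "x [^]\<^bsub>M\<lparr>carrier := W\<rparr>\<^esub> (p ^ k) = \<one>"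
      using pow_order[OF finite_M, of x] xW W order_M by (auto simp: nat_pow_carrier_update)
    then have "W.ord x dvd p ^ k" using W.pow_eq_id[of x "p ^ k"] xW by simp
    moreover have "coprime q (p ^ k)" using q(1) prime_p \<open>q \<noteq> p\<close> by (simp add: primes_coprime)
    ultimately have "W.ord x = 1" by (metis coprime_common_divisor_nat)
    then show False using W.ord_eq_1[of x] xW x(2) by simp
  qed
  then obtain j where j: "order (M\<lparr>carrier := W\<rparr>) = p ^ j"
    using prime_power_if_unique_prime_divisor[OF pos prime_p] by blast
  have sub: "subloop H M" if "subgroup H (M\<lparr>carrier := W\<rparr>)" for H
    using that W.subgroup_imp_group[OF that] subgroup.subset[OF that] W group_imp_loop
    by (auto simp: subloop_def)
  have "unique_order_p_group (M\<lparr>carrier := W\<rparr>) p j"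
    by unfold_locales (use prime_p j sub unique_subloop in auto)
  then show thesis by (rule that)
qed

lemma cyclic_if_odd:
  assumes "p \<noteq> 2"
  shows "is_cyclic_group M"
proof -
  obtain x where x: "x \<in> carrier M"
    and max: "\<And>z. z \<in> carrier M \<Longrightarrow> card (nat_powers z) \<le> card (nat_powers x)"
  proof -
    have "card (nat_powers z) < Suc (card (carrier M))" if "z \<in> carrier M" for z
      using card_mono[OF finite_M, of "nat_powers z"] pow_closed that by (auto simp: less_Suc_eq_le)
    then show thesis
      using ex_has_greatest_nat[of "\<lambda>z. z \<in> carrier M" \<one> "\<lambda>z. card (nat_powers z)"
          "Suc (card (carrier M))"] one_closed that by blast
  qed
  have "y \<in> nat_powers x" if y: "y \<in> carrier M" for y
  proof -
    obtain W where W: "W \<subseteq> carrier M" "x \<in> W" "y \<in> W" "group (M\<lparr>carrier := W\<rparr>)"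
      using two_generated_group[OF finite_M x y] .
    obtain j where "unique_order_p_group (M\<lparr>carrier := W\<rparr>) p j"
      using unique_order_p_subgroup W by blast
    then interpret W: unique_order_p_group "M\<lparr>carrier := W\<rparr>" p j .
    obtain z where z: "z \<in> W" "W = W.powers z"
      by (cases rule: W.cyclic_or_quaternion) (use assms in auto)
    then have Wz: "W = nat_powers z"
      using W.powers_finite[OF W.finite_G, of z] by (simp add: nat_pow_carrier_update)
    have zM: "z \<in> carrier M" using z W by blast
    obtain i :: nat where i: "x = z [^] i" using W Wz by auto
    have "nat_powers x \<subseteq> nat_powers z" unfolding i using zM by (auto simp: pow_pow)
    moreover have "finite (nat_powers z)" using W Wz finite_M finite_subset by metis
    \<comment> \<open>Maximality of \<open>x\<close> leaves no room for a larger cyclic subloop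
      containing it, so \<open>y\<close> is already a power of \<open>x\<close>.\<close>
    ultimately have "nat_powers x = nat_powers z" using max[OF zM] card_seteq by blast
    then show ?thesis using W Wz by simp
  qed
  then have M: "carrier M = nat_powers x" using pow_closed x by auto
  have "M\<lparr>carrier := nat_powers x\<rparr> = M" using M by simp
  then have grp: "group M" using group_nat_powers[OF finite_M x] by simp
  interpret G: group M by (rule grp)
  have "carrier M = G.powers x" using M G.powers_finite finite_M x by simp
  then have "cyclic_group M" using G.cyclic_group x by blast
  then show ?thesis using grp by (simp add: is_cyclic_group_def)
qed

text \<open>In the quaternion alternative, commutativity would give a = a^-1, so the order of
  \<open>a\<close> would divide 2, although it is 2 * 2^l with l at least 1.\<close>

lemma abelian_subloop_cyclic:
  assumes "abelian_subloop H M"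
  shows "is_cyclic_group (M\<lparr>carrier := H\<rparr>)"
proof -
  have H: "H \<subseteq> carrier M" "group (M\<lparr>carrier := H\<rparr>)"
    using assms associative_loop_imp_group by (auto simp: abelian_subloop_def subloop_def)
  have comm: "x \<otimes> y = y \<otimes> x" if "x \<in> H" "y \<in> H" for x y
    using assms that by (simp add: abelian_subloop_def commutative_loop_def)
  obtain j where "unique_order_p_group (M\<lparr>carrier := H\<rparr>) p j"
    using unique_order_p_subgroup H by blast
  then interpret H: unique_order_p_group "M\<lparr>carrier := H\<rparr>" p j .
  show ?thesis
  proof (cases rule: H.cyclic_or_quaternion)
    case (cyclic a)
    then show ?thesis using H.cyclic_group H(2) unfolding is_cyclic_group_def by blast
  next
    case (quaternion a b l)
    let ?i = "inv\<^bsub>M\<lparr>carrier := H\<rparr>\<^esub> a"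
    have "b \<otimes>\<^bsub>M\<lparr>carrier := H\<rparr>\<^esub> a = b \<otimes>\<^bsub>M\<lparr>carrier := H\<rparr>\<^esub> ?i"
      using quaternion comm by simp
    then have "a = ?i" using H.inv_closed quaternion(3,4) H.Units_l_cancel by simp
    then have "a \<otimes>\<^bsub>M\<lparr>carrier := H\<rparr>\<^esub> a = \<one>\<^bsub>M\<lparr>carrier := H\<rparr>\<^esub>"
      using H.r_inv[OF quaternion(3)] by metis
    then have "H.ord a dvd 2"
      using H.pow_eq_id[OF quaternion(3), of 2] quaternion(3) H.l_one by (simp add: numeral_2_eq_2)
    then have "2 * 2 ^ l dvd (2::nat)" using quaternion(5) by simp
    then have "2 * 2 ^ l \<le> (2::nat)" by (rule dvd_imp_le) simp
    moreover have "(2::nat) ^ 1 \<le> 2 ^ l" using quaternion(2) by (intro power_increasing) auto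
    ultimately show ?thesis by simp
  qed
qed

lemma associative_cyclic_or_quaternion:
  assumes "associative_loop M"
  shows "is_cyclic_group M \<or> generalized_quaternion_group M"
proof -
  have grp: "group M" using assms by (rule associative_loop_imp_group)
  obtain j where "unique_order_p_group (M\<lparr>carrier := carrier M\<rparr>) p j"
    using unique_order_p_subgroup[of "carrier M"] grp by auto
  then interpret G: unique_order_p_group M p j by simp
  show ?thesis
  proof (cases rule: G.cyclic_or_quaternion)
    case (cyclic a)
    then show ?thesis using G.cyclic_group grp unfolding is_cyclic_group_def by blast
  next
    case (quaternion a b l)
    then have "M \<cong> quaternion_group (2 ^ l)" by (intro G.iso_quaternion_group)
    moreover have "(2::nat) ^ 1 \<le> 2 ^ l" using quaternion(2) by (intro power_increasing) auto
    ultimately show ?thesis using grp unfolding generalized_quaternion_group_def by auto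
  qed
qed

text \<open>The loop is cyclic of odd order, so an isomorphic quaternion group would be commutative
  of odd order and hence trivial. The subloop of order \<open>p\<close> excludes this.\<close>

lemma not_quaternion_if_odd:
  assumes "p \<noteq> 2"
  shows "\<not> generalized_quaternion_group M"
proof
  assume "generalized_quaternion_group M"
  then obtain n where "M \<cong> quaternion_group n" by (auto simp: generalized_quaternion_group_def)
  then obtain h where h: "h \<in> iso M (quaternion_group n)" by (auto simp: is_iso_def)
  have cyc: "group M" "cyclic_group M" using cyclic_if_odd[OF assms] by (auto simp: is_cyclic_group_def)
  interpret G: comm_group M using group.cyclic_imp_abelian_group[OF cyc] .
  have ord_eq: "order (quaternion_group n) = p ^ k"
    using iso_same_order[OF h] order_M by simp
  have img: "carrier (quaternion_group n) = h ` carrier M"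
    using h by (auto simp: iso_def bij_betw_def)
  have hm: "h (x \<otimes> y) = h x \<otimes>\<^bsub>quaternion_group n\<^esub> h y" if "x \<in> carrier M" "y \<in> carrier M" for x y
    using h that by (auto simp: iso_def hom_def)
  have "order (quaternion_group n) = 1"
  proof (rule commutative_odd_quaternion_group)
    show "odd (order (quaternion_group n))"
      using ord_eq prime_p assms prime_odd_nat[of p] prime_ge_2_nat[of p] by auto
    fix x y assume "x \<in> carrier (quaternion_group n)" "y \<in> carrier (quaternion_group n)"
    then obtain u v where "u \<in> carrier M" "v \<in> carrier M" "x = h u" "y = h v" using img by auto
    then show "x \<otimes>\<^bsub>quaternion_group n\<^esub> y = y \<otimes>\<^bsub>quaternion_group n\<^esub> x"
      using hm[of u v] hm[of v u] G.m_comm by simp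
  qed
  then have "card (carrier M) = 1" using ord_eq order_M by (simp add: order_def)
  moreover obtain H where "H \<subseteq> carrier M" "card H = p" using unique_subloop by (auto simp: subloop_def)
  ultimately have "p \<le> 1" using card_mono[OF finite_M, of H] by simp
  then show False using prime_p prime_ge_2_nat[of p] by simp
qed

end

theorem theorem1p2:
  fixes M :: "('a, 'b) monoid_scheme" and p :: nat
  assumes "prime p"
    and "moufang_p_loop p M"
    and "\<exists>!H. subloop H M \<and> card H = p"
  shows "(is_cyclic_group M \<or> generalized_quaternion_group M \<or> generalized_octonion_loop M)
       \<and> (generalized_quaternion_group M \<or> generalized_octonion_loop M \<longrightarrow> p = 2)"
proof -
  obtain k where "order M = p ^ k" and "moufang_loop M"
    using assms(2) by (auto simp: moufang_p_loop_def)
  then interpret unique_order_p_moufang M p k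
    using assms by (simp add: unique_order_p_moufang_def unique_order_p_moufang_axioms_def)
  have "generalized_octonion_loop M" if "\<not> associative_loop M"
    using that assms(2) abelian_subloop_cyclic unfolding generalized_octonion_loop_def by blast
  \<comment> \<open>For odd \<open>p\<close> the loop is a cyclic group, and associativity excludes
    the octonion case.\<close>
  moreover have "associative_loop M" if "p \<noteq> 2"
    using cyclic_if_odd[OF that] by (intro group_imp_associative_loop) (simp add: is_cyclic_group_def)
  ultimately show ?thesis
    using associative_cyclic_or_quaternion not_quaternion_if_odd
    unfolding generalized_octonion_loop_def by blast
qed

end
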